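(* Let $\mathcal{C}$ be an abelian category, $m\ge1$, and $\mathcal{A},\mathcal{B}\subseteq\mathcal{C}$ classes with $\mathrm{Ext}^1(\mathcal{A},\mathcal{B})=0$, such that $\omega:=\mathcal{A}\cap\mathcal{B}$ is closed under finite coproducts and direct summands. Write $\mathcal{P}:=\pi\mathcal{GP}^{\mathrm{ppr}}_{(\omega,\mathcal{B},m)}$. (1) If $M=N\oplus W$ with $W\in\omega$, then $M\in\mathcal{P}$ if and only if $N\in\mathcal{P}$. (2) The following are equivalent: (a) $\mathcal{P}$ is closed under extensions: for every short exact sequence $0\to X\to Y\to Z\to0$ with $X,Z\in\mathcal{P}$, one has $Y\in\mathcal{P}$; (b) for every short exact sequence $0\to X\to Y\to Z\to0$ with $Y,Z\in\mathcal{P}$, one has $X\in\mathcal{P}$ if and only if $X\in\omega^{\perp_1}$; (c) for every short exact sequence $0\to X\to Y\to Z\to0$ with $X,Y\in\mathcal{P}$, one has $Z\in\mathcal{P}$ if and only if $Z\in{}^{\perp_1}\mathcal{B}$.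
   Context: $\mathrm{Ext}^1(\mathcal{A},\mathcal{B})=0$ means $\mathrm{Ext}^1(A,B)=0$ for all $A\in\mathcal{A}$, $B\in\mathcal{B}$. $\omega^{\perp_1}=\{N:\mathrm{Ext}^1(W,N)=0\ \forall W\in\omega\}$, ${}^{\perp_1}\mathcal{B}=\{N:\mathrm{Ext}^1(N,B)=0\ \forall B\in\mathcal{B}\}$. For a class $\mathcal{X}$, an $\mathcal{X}$-loop at $M$ of length $m$ is an exact chain complex $X_\bullet$ with components in $\mathcal{X}$ and $Z_{km}(X_\bullet)\cong M$ for every $k\in\mathbb{Z}$ ($Z_k$ = $k$-th cycle). $\pi\mathcal{GP}^{\mathrm{ppr}}_{(\mathcal{X},\mathcal{Y},m)}$ (proper $m$-periodic $(\mathcal{X},\mathcal{Y})$-Gorenstein projective objects) is the class of $M$ admitting an $\mathcal{X}$-loop $X_\bullet$ at $M$ of length $m$ which is both $\mathrm{Hom}(\mathcal{X},-)$-acyclic ($\mathrm{Hom}(X,X_\bullet)$ exact for all $X\in\mathcal{X}$) and $\mathrm{Hom}(-,\mathcal{Y})$-acyclic ($\mathrm{Hom}(X_\bullet,Y)$ exact for all $Y\in\mathcal{Y}$). *)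

theory Defs
  imports Main
begin

record ('o, 'm) category =
  c_obj  :: "'o set"
  c_arr  :: "'m set"
  c_dom  :: "'m \<Rightarrow> 'o"
  c_cod  :: "'m \<Rightarrow> 'o"
  c_comp :: "'m \<Rightarrow> 'm \<Rightarrow> 'm"   (* c_comp C g f = g after f *)
  c_id   :: "'o \<Rightarrow> 'm"

definition hom :: "('o,'m) category \<Rightarrow> 'o \<Rightarrow> 'o \<Rightarrow> 'm set" where
  "hom C X Y = {f. f \<in> c_arr C \<and> c_dom C f = X \<and> c_cod C f = Y}"

definition is_category :: "('o,'m) category \<Rightarrow> bool" where
  "is_category C \<longleftrightarrow>
     (\<forall>X\<in>c_obj C. c_id C X \<in> hom C X X) \<and>
     (\<forall>f\<in>c_arr C. c_dom C f \<in> c_obj C \<and> c_cod C f \<in> c_obj C) \<and>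
     (\<forall>f g. f \<in> c_arr C \<and> g \<in> c_arr C \<and> c_cod C f = c_dom C g
        \<longrightarrow> c_comp C g f \<in> hom C (c_dom C f) (c_cod C g)) \<and>
     (\<forall>f\<in>c_arr C. c_comp C f (c_id C (c_dom C f)) = f \<and> c_comp C (c_id C (c_cod C f)) f = f) \<and>
     (\<forall>f g h. f \<in> c_arr C \<and> g \<in> c_arr C \<and> h \<in> c_arr C \<and>
        c_cod C f = c_dom C g \<and> c_cod C g = c_dom C h
        \<longrightarrow> c_comp C h (c_comp C g f) = c_comp C (c_comp C h g) f)"

definition zero_obj :: "('o,'m) category \<Rightarrow> 'o \<Rightarrow> bool" where
  "zero_obj C Z \<longleftrightarrow> Z \<in> c_obj C \<and>
     (\<forall>X\<in>c_obj C. (\<exists>!f. f \<in> hom C Z X) \<and> (\<exists>!f. f \<in> hom C X Z))"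

definition zero_mor :: "('o,'m) category \<Rightarrow> 'm \<Rightarrow> bool" where
  "zero_mor C h \<longleftrightarrow> h \<in> c_arr C \<and>
     (\<exists>Z g1 g2. zero_obj C Z \<and> g1 \<in> hom C (c_dom C h) Z \<and> g2 \<in> hom C Z (c_cod C h)
        \<and> h = c_comp C g2 g1)"

definition mono :: "('o,'m) category \<Rightarrow> 'm \<Rightarrow> bool" where
  "mono C f \<longleftrightarrow> f \<in> c_arr C \<and>
     (\<forall>g h. g \<in> c_arr C \<and> h \<in> c_arr C \<and> c_cod C g = c_dom C f \<and> c_cod C h = c_dom C f
        \<and> c_dom C g = c_dom C h \<and> c_comp C f g = c_comp C f h \<longrightarrow> g = h)"

definition epi :: "('o,'m) category \<Rightarrow> 'm \<Rightarrow> bool" where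
  "epi C f \<longleftrightarrow> f \<in> c_arr C \<and>
     (\<forall>g h. g \<in> c_arr C \<and> h \<in> c_arr C \<and> c_dom C g = c_cod C f \<and> c_dom C h = c_cod C f
        \<and> c_cod C g = c_cod C h \<and> c_comp C g f = c_comp C h f \<longrightarrow> g = h)"

definition iso_mor :: "('o,'m) category \<Rightarrow> 'm \<Rightarrow> bool" where
  "iso_mor C f \<longleftrightarrow> f \<in> c_arr C \<and>
     (\<exists>g\<in>hom C (c_cod C f) (c_dom C f).
        c_comp C g f = c_id C (c_dom C f) \<and> c_comp C f g = c_id C (c_cod C f))"

definition isomorphic :: "('o,'m) category \<Rightarrow> 'o \<Rightarrow> 'o \<Rightarrow> bool" where
  "isomorphic C X Y \<longleftrightarrow> (\<exists>f\<in>hom C X Y. iso_mor C f)"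

definition is_product :: "('o,'m) category \<Rightarrow> 'o \<Rightarrow> 'o \<Rightarrow> 'o \<Rightarrow> 'm \<Rightarrow> 'm \<Rightarrow> bool" where
  "is_product C A B P p q \<longleftrightarrow> P \<in> c_obj C \<and> p \<in> hom C P A \<and> q \<in> hom C P B \<and>
     (\<forall>T f g. f \<in> hom C T A \<and> g \<in> hom C T B \<longrightarrow>
        (\<exists>!u. u \<in> hom C T P \<and> c_comp C p u = f \<and> c_comp C q u = g))"

definition is_coproduct :: "('o,'m) category \<Rightarrow> 'o \<Rightarrow> 'o \<Rightarrow> 'o \<Rightarrow> 'm \<Rightarrow> 'm \<Rightarrow> bool" where
  "is_coproduct C A B S i j \<longleftrightarrow> S \<in> c_obj C \<and> i \<in> hom C A S \<and> j \<in> hom C B S \<and>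
     (\<forall>T f g. f \<in> hom C A T \<and> g \<in> hom C B T \<longrightarrow>
        (\<exists>!u. u \<in> hom C S T \<and> c_comp C u i = f \<and> c_comp C u j = g))"

definition is_kernel :: "('o,'m) category \<Rightarrow> 'm \<Rightarrow> 'm \<Rightarrow> bool" where
  "is_kernel C f k \<longleftrightarrow> f \<in> c_arr C \<and> k \<in> c_arr C \<and> c_cod C k = c_dom C f \<and>
     zero_mor C (c_comp C f k) \<and>
     (\<forall>g. g \<in> c_arr C \<and> c_cod C g = c_dom C f \<and> zero_mor C (c_comp C f g) \<longrightarrow>
        (\<exists>!u. u \<in> hom C (c_dom C g) (c_dom C k) \<and> c_comp C k u = g))"

definition is_cokernel :: "('o,'m) category \<Rightarrow> 'm \<Rightarrow> 'm \<Rightarrow> bool" where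
  "is_cokernel C f c \<longleftrightarrow> f \<in> c_arr C \<and> c \<in> c_arr C \<and> c_dom C c = c_cod C f \<and>
     zero_mor C (c_comp C c f) \<and>
     (\<forall>g. g \<in> c_arr C \<and> c_dom C g = c_cod C f \<and> zero_mor C (c_comp C g f) \<longrightarrow>
        (\<exists>!u. u \<in> hom C (c_cod C c) (c_cod C g) \<and> c_comp C u c = g))"

text \<open>Abelian category (Freyd's axioms): zero object, binary products and coproducts,
  kernels and cokernels, every mono is a kernel and every epi is a cokernel.\<close>
definition abelian :: "('o,'m) category \<Rightarrow> bool" where
  "abelian C \<longleftrightarrow> is_category C \<and> (\<exists>Z. zero_obj C Z) \<and>
     (\<forall>A\<in>c_obj C. \<forall>B\<in>c_obj C. (\<exists>P p q. is_product C A B P p q) \<and> (\<exists>S i j. is_coproduct C A B S i j)) \<and>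
     (\<forall>f\<in>c_arr C. (\<exists>k. is_kernel C f k) \<and> (\<exists>c. is_cokernel C f c)) \<and>
     (\<forall>f. mono C f \<longrightarrow> (\<exists>g. is_kernel C g f)) \<and>
     (\<forall>f. epi C f \<longrightarrow> (\<exists>g. is_cokernel C g f))"

text \<open>A --f--> B --g--> D is exact at B: g f = 0 and the induced map from A to the kernel of g is epi
  (i.e. image f = kernel g).\<close>
definition exact_at :: "('o,'m) category \<Rightarrow> 'm \<Rightarrow> 'm \<Rightarrow> bool" where
  "exact_at C f g \<longleftrightarrow> f \<in> c_arr C \<and> g \<in> c_arr C \<and> c_cod C f = c_dom C g \<and>
     zero_mor C (c_comp C g f) \<and>
     (\<exists>k u. is_kernel C g k \<and> u \<in> hom C (c_dom C f) (c_dom C k) \<and> c_comp C k u = f \<and> epi C u)"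

definition short_exact :: "('o,'m) category \<Rightarrow> 'o \<Rightarrow> 'o \<Rightarrow> 'o \<Rightarrow> 'm \<Rightarrow> 'm \<Rightarrow> bool" where
  "short_exact C X Y Z f g \<longleftrightarrow> f \<in> hom C X Y \<and> g \<in> hom C Y Z \<and>
     mono C f \<and> epi C g \<and> exact_at C f g"

text \<open>Ext^1(A,B) = 0 (Yoneda): every extension 0 \<rightarrow> B \<rightarrow> E \<rightarrow> A \<rightarrow> 0 splits.\<close>
definition Ext1_zero :: "('o,'m) category \<Rightarrow> 'o \<Rightarrow> 'o \<Rightarrow> bool" where
  "Ext1_zero C A B \<longleftrightarrow>
     (\<forall>E f g. short_exact C B E A f g \<longrightarrow> (\<exists>r\<in>hom C E B. c_comp C r f = c_id C B))"

definition Ext1_zero_classes :: "('o,'m) category \<Rightarrow> 'o set \<Rightarrow> 'o set \<Rightarrow> bool" where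
  "Ext1_zero_classes C \<A> \<B> \<longleftrightarrow> (\<forall>A\<in>\<A>. \<forall>B\<in>\<B>. Ext1_zero C A B)"

definition right_perp1 :: "('o,'m) category \<Rightarrow> 'o set \<Rightarrow> 'o set" where
  "right_perp1 C \<W> = {N \<in> c_obj C. \<forall>W\<in>\<W>. Ext1_zero C W N}"

definition left_perp1 :: "('o,'m) category \<Rightarrow> 'o set \<Rightarrow> 'o set" where
  "left_perp1 C \<B> = {N \<in> c_obj C. \<forall>B\<in>\<B>. Ext1_zero C N B}"

definition chain_complex :: "('o,'m) category \<Rightarrow> (int \<Rightarrow> 'o) \<Rightarrow> (int \<Rightarrow> 'm) \<Rightarrow> bool" where
  "chain_complex C X d \<longleftrightarrow> (\<forall>n. X n \<in> c_obj C \<and> d n \<in> hom C (X n) (X (n - 1)) \<and>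
      zero_mor C (c_comp C (d (n - 1)) (d n)))"

definition exact_complex :: "('o,'m) category \<Rightarrow> (int \<Rightarrow> 'o) \<Rightarrow> (int \<Rightarrow> 'm) \<Rightarrow> bool" where
  "exact_complex C X d \<longleftrightarrow> chain_complex C X d \<and> (\<forall>n. exact_at C (d (n + 1)) (d n))"

definition cycle_iso :: "('o,'m) category \<Rightarrow> (int \<Rightarrow> 'o) \<Rightarrow> (int \<Rightarrow> 'm) \<Rightarrow> int \<Rightarrow> 'o \<Rightarrow> bool" where
  "cycle_iso C X d n M \<longleftrightarrow> (\<exists>k. is_kernel C (d n) k \<and> isomorphic C (c_dom C k) M)"

definition hom_from_acyclic :: "('o,'m) category \<Rightarrow> 'o \<Rightarrow> (int \<Rightarrow> 'o) \<Rightarrow> (int \<Rightarrow> 'm) \<Rightarrow> bool" where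
  "hom_from_acyclic C W X d \<longleftrightarrow> (\<forall>n. \<forall>f\<in>hom C W (X n). zero_mor C (c_comp C (d n) f) \<longrightarrow>
      (\<exists>g\<in>hom C W (X (n + 1)). c_comp C (d (n + 1)) g = f))"

definition hom_to_acyclic :: "('o,'m) category \<Rightarrow> 'o \<Rightarrow> (int \<Rightarrow> 'o) \<Rightarrow> (int \<Rightarrow> 'm) \<Rightarrow> bool" where
  "hom_to_acyclic C Y X d \<longleftrightarrow> (\<forall>n. \<forall>f\<in>hom C (X n) Y. zero_mor C (c_comp C f (d (n + 1))) \<longrightarrow>
      (\<exists>g\<in>hom C (X (n - 1)) Y. c_comp C g (d n) = f))"

definition is_loop :: "('o,'m) category \<Rightarrow> 'o set \<Rightarrow> nat \<Rightarrow> 'o \<Rightarrow> (int \<Rightarrow> 'o) \<Rightarrow> (int \<Rightarrow> 'm) \<Rightarrow> bool" where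
  "is_loop C \<X> m M X d \<longleftrightarrow> exact_complex C X d \<and> (\<forall>n. X n \<in> \<X>) \<and>
     (\<forall>k::int. cycle_iso C X d (k * int m) M)"

definition piGP_ppr :: "('o,'m) category \<Rightarrow> 'o set \<Rightarrow> 'o set \<Rightarrow> nat \<Rightarrow> 'o set" where
  "piGP_ppr C \<X> \<Y> m = {M \<in> c_obj C. \<exists>X d. is_loop C \<X> m M X d \<and>
      (\<forall>W\<in>\<X>. hom_from_acyclic C W X d) \<and> (\<forall>Y\<in>\<Y>. hom_to_acyclic C Y X d)}"

definition closed_fin_coproducts :: "('o,'m) category \<Rightarrow> 'o set \<Rightarrow> bool" where
  "closed_fin_coproducts C \<W> \<longleftrightarrow> (\<forall>Z. zero_obj C Z \<longrightarrow> Z \<in> \<W>) \<and>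
     (\<forall>A B S i j. A \<in> \<W> \<and> B \<in> \<W> \<and> is_coproduct C A B S i j \<longrightarrow> S \<in> \<W>)"

definition closed_summands :: "('o,'m) category \<Rightarrow> 'o set \<Rightarrow> bool" where
  "closed_summands C \<W> \<longleftrightarrow>
     (\<forall>A B S i j. S \<in> \<W> \<and> A \<in> c_obj C \<and> B \<in> c_obj C \<and> is_coproduct C A B S i j \<longrightarrow> A \<in> \<W> \<and> B \<in> \<W>)"

end

theory Submission
  imports Defs
begin

text \<open>Splitting a proper loop at its cycles shows that \<open>M\<close> lies in \<open>\<P>\<close> iff \<open>M\<close> lies on a closed
  walk of length \<open>m\<close> for the relation relating \<open>x\<close> to \<open>y\<close> when there is a short exact sequence
  \<open>0 \<rightarrow> x \<rightarrow> E \<rightarrow> y \<rightarrow> 0\<close> with \<open>E \<in> \<omega>\<close> and both ends in \<open>\<omega>\<^sup>\<bottom> \<inter> \<^sup>\<bottom>\<B>\<close>. Every object on such a walk is in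
  \<open>\<P>\<close>. The Ext-vanishing makes summands from \<open>\<omega>\<close> split off or adjoinable at either end of a step, which
  gives (1). For (2), the pullback of a sequence \<open>0 \<rightarrow> X \<rightarrow> Y \<rightarrow> Z \<rightarrow> 0\<close> along the step \<open>N \<rightarrow> W \<rightarrow> Z\<close>
  has the form \<open>X \<oplus> W\<close> and is an extension of \<open>Y\<close> by \<open>N\<close>; pushouts are dual. The arguments need no
  addition of morphisms, so everything is derived directly from Freyd's axioms.\<close>


section \<open>The opposite category\<close>

text \<open>The orthogonality demanded of both ends of a step is acyclicity in disguise. Along
  \<open>0 -> c n -> X n -> c (n - 1) -> 0\<close>, where the \<open>c n\<close> are the cycles,
  acyclicity says that maps from \<omega> into \<open>c (n - 1)\<close> lift to \<open>X n\<close>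
  and that maps from \<open>c n\<close> to \<B> extend to \<open>X n\<close>. As
  \<open>Ext^1\<close> from \<omega> to the components and from the components to \<B> vanishes,
  this amounts to \<open>Ext^1\<close> vanishing on the cycles themselves, a condition that can be
  tested one step at a time. Part (2) rests on part (1): the object built by pullback or pushout is
  an extension whose splitting is forced by orthogonality, and the extra summand from \<omega> is
  then cancelled or added by (1). The perpendicularity conditions in (b) and (c) are exactly what
  forces or permits this splitting. Condition (c) is (b) read in the opposite category, where every
  walk is reversed. Isomorphisms are treated as direct sums with a zero object, so invariance under
  isomorphism is a special case of moving summands.\<close>

definition op_cat :: "('o,'m) category \<Rightarrow> ('o,'m) category" where
  "op_cat C = \<lparr>c_obj = c_obj C, c_arr = c_arr C, c_dom = c_cod C, c_cod = c_dom C,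
     c_comp = (\<lambda>g f. c_comp C f g), c_id = c_id C\<rparr>"

lemma op_cat_simps [simp]:
  "c_obj (op_cat C) = c_obj C" "c_arr (op_cat C) = c_arr C"
  "c_dom (op_cat C) = c_cod C" "c_cod (op_cat C) = c_dom C"
  "c_comp (op_cat C) g f = c_comp C f g" "c_id (op_cat C) = c_id C"
  by (simp_all add: op_cat_def)

lemma op_cat_op_cat [simp]: "op_cat (op_cat C) = C"
  by (simp add: op_cat_def)

lemma hom_op_cat [simp]: "hom (op_cat C) X Y = hom C Y X"
  by (auto simp: hom_def)

lemma is_category_op_cat: "is_category C \<Longrightarrow> is_category (op_cat C)"
  by (simp add: is_category_def hom_def)

lemma zero_obj_op_cat [simp]: "zero_obj (op_cat C) = zero_obj C"
  by (auto simp: zero_obj_def fun_eq_iff)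

lemma zero_mor_op_cat [simp]: "zero_mor (op_cat C) = zero_mor C"
  by (auto simp: zero_mor_def fun_eq_iff)

lemma mono_op_cat [simp]: "mono (op_cat C) = epi C"
  by (auto simp: mono_def epi_def fun_eq_iff)

lemma epi_op_cat [simp]: "epi (op_cat C) = mono C"
  by (auto simp: mono_def epi_def fun_eq_iff)

lemma is_product_op_cat [simp]: "is_product (op_cat C) = is_coproduct C"
  by (simp add: is_product_def is_coproduct_def fun_eq_iff)

lemma is_coproduct_op_cat [simp]: "is_coproduct (op_cat C) = is_product C"
  by (simp add: is_product_def is_coproduct_def fun_eq_iff)

lemma is_kernel_op_cat [simp]: "is_kernel (op_cat C) = is_cokernel C"
  by (simp add: is_kernel_def is_cokernel_def fun_eq_iff)

lemma is_cokernel_op_cat [simp]: "is_cokernel (op_cat C) = is_kernel C"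
  by (simp add: is_kernel_def is_cokernel_def fun_eq_iff)

lemma abelian_op_cat: "abelian C \<Longrightarrow> abelian (op_cat C)"
  by (simp add: abelian_def is_category_op_cat)


section \<open>Elementary theory of abelian categories\<close>

locale abelian_category =
  fixes C :: "('o,'m) category"
  assumes abelian: "abelian C"
begin

abbreviation comp (infixr "\<cdot>" 70) where "g \<cdot> f \<equiv> c_comp C g f"
abbreviation ident ("\<one>") where "\<one> \<equiv> c_id C"
abbreviation Hom where "Hom \<equiv> hom C"

text \<open>Freyd's axioms are self-dual, so a lemma of the locale may be instantiated at
  \<open>op_cat C\<close>. This is the usual source of the second half of a dual pair below.\<close>

lemma dual: "abelian_category (op_cat C)"
  by (simp add: abelian_category_def abelian abelian_op_cat)

lemma is_cat: "is_category C"
  using abelian by (simp add: abelian_def)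

lemma category_axioms:
  "\<forall>X\<in>c_obj C. \<one> X \<in> Hom X X"
  "\<forall>f\<in>c_arr C. c_dom C f \<in> c_obj C \<and> c_cod C f \<in> c_obj C"
  "\<forall>f g. f \<in> c_arr C \<and> g \<in> c_arr C \<and> c_cod C f = c_dom C g
        \<longrightarrow> g \<cdot> f \<in> Hom (c_dom C f) (c_cod C g)"
  "\<forall>f\<in>c_arr C. f \<cdot> \<one> (c_dom C f) = f \<and> \<one> (c_cod C f) \<cdot> f = f"
  "\<forall>f g h. f \<in> c_arr C \<and> g \<in> c_arr C \<and> h \<in> c_arr C \<and>
        c_cod C f = c_dom C g \<and> c_cod C g = c_dom C h \<longrightarrow> h \<cdot> g \<cdot> f = (h \<cdot> g) \<cdot> f"
  using is_cat unfolding is_category_def by - (elim conjE, assumption)+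

lemma abelian_axioms:
  "\<exists>Z. zero_obj C Z"
  "\<forall>A\<in>c_obj C. \<forall>B\<in>c_obj C.
     (\<exists>P p q. is_product C A B P p q) \<and> (\<exists>S i j. is_coproduct C A B S i j)"
  "\<forall>f\<in>c_arr C. (\<exists>k. is_kernel C f k) \<and> (\<exists>c. is_cokernel C f c)"
  "\<forall>f. mono C f \<longrightarrow> (\<exists>g. is_kernel C g f)"
  using abelian unfolding abelian_def by - (elim conjE, assumption)+

lemma hom_arr: "f \<in> Hom X Y \<Longrightarrow> f \<in> c_arr C" "f \<in> Hom X Y \<Longrightarrow> c_dom C f = X"
  "f \<in> Hom X Y \<Longrightarrow> c_cod C f = Y"
  by (auto simp: hom_def)

lemma hom_obj: "f \<in> Hom X Y \<Longrightarrow> X \<in> c_obj C" "f \<in> Hom X Y \<Longrightarrow> Y \<in> c_obj C"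
  using category_axioms(2) hom_arr by metis+

lemma id_hom: "X \<in> c_obj C \<Longrightarrow> \<one> X \<in> Hom X X"
  using category_axioms(1) by blast

lemma comp_hom: "f \<in> Hom X Y \<Longrightarrow> g \<in> Hom Y Z \<Longrightarrow> g \<cdot> f \<in> Hom X Z"
  using category_axioms(3) hom_arr by metis

lemma comp_id: "f \<in> Hom X Y \<Longrightarrow> f \<cdot> \<one> X = f"
  and id_comp: "f \<in> Hom X Y \<Longrightarrow> \<one> Y \<cdot> f = f"
  using category_axioms(4) hom_arr by metis+

lemma comp_assoc:
  "f \<in> Hom W X \<Longrightarrow> g \<in> Hom X Y \<Longrightarrow> h \<in> Hom Y Z \<Longrightarrow> h \<cdot> g \<cdot> f = (h \<cdot> g) \<cdot> f"
  using category_axioms(5) hom_arr by metis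

section \<open>Zero objects and zero morphisms\<close>

lemma zero_obj_ex: obtains Z\<^sub>0 where "zero_obj C Z\<^sub>0"
  using abelian_axioms(1) by blast

lemma zero_objD:
  assumes "zero_obj C Z" "X \<in> c_obj C"
  shows "Z \<in> c_obj C" "\<exists>f. f \<in> Hom Z X" "\<exists>f. f \<in> Hom X Z"
    "f \<in> Hom Z X \<Longrightarrow> g \<in> Hom Z X \<Longrightarrow> f = g" "f \<in> Hom X Z \<Longrightarrow> g \<in> Hom X Z \<Longrightarrow> f = g"
proof -
  have u: "\<exists>!f. f \<in> Hom Z X" "\<exists>!f. f \<in> Hom X Z"
    using assms by (simp_all add: zero_obj_def)
  show "Z \<in> c_obj C" using assms by (simp add: zero_obj_def)
  show "\<exists>f. f \<in> Hom Z X" "\<exists>f. f \<in> Hom X Z" using u ex1_implies_ex by fast+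
  show "f \<in> Hom Z X \<Longrightarrow> g \<in> Hom Z X \<Longrightarrow> f = g" using u(1) by fast
  show "f \<in> Hom X Z \<Longrightarrow> g \<in> Hom X Z \<Longrightarrow> f = g" using u(2) by fast
qed

text \<open>The map \<open>h\<close> between the two zero objects identifies the two
  factorisations.\<close>

lemma zero_mor_unique:
  assumes "zero_mor C f" "zero_mor C g" "f \<in> Hom X Y" "g \<in> Hom X Y"
  shows "f = g"
proof -
  obtain Z\<^sub>0 f1 f2 where f: "zero_obj C Z\<^sub>0" "f1 \<in> Hom X Z\<^sub>0" "f2 \<in> Hom Z\<^sub>0 Y" "f = f2 \<cdot> f1"
    using assms by (auto simp: zero_mor_def hom_def)
  obtain Z\<^sub>1 g1 g2 where g: "zero_obj C Z\<^sub>1" "g1 \<in> Hom X Z\<^sub>1" "g2 \<in> Hom Z\<^sub>1 Y" "g = g2 \<cdot> g1"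
    using assms by (auto simp: zero_mor_def hom_def)
  have obj: "X \<in> c_obj C" "Y \<in> c_obj C" "Z\<^sub>1 \<in> c_obj C"
    using assms(3) g(2) hom_obj by blast+
  then obtain h where h: "h \<in> Hom Z\<^sub>0 Z\<^sub>1"
    using zero_objD(2)[OF f(1)] by blast
  have "h \<cdot> f1 = g1"
    using zero_objD(5)[OF g(1)] comp_hom[OF f(2) h] g(2) obj by blast
  moreover have "g2 \<cdot> h = f2"
    using zero_objD(4)[OF f(1)] comp_hom[OF h g(3)] f(3) obj by blast
  ultimately show ?thesis
    using f g comp_assoc[OF f(2) h g(3)] by simp
qed

text \<open>Turns the predicate \<open>zero_mor\<close> into a named element of each hom-set, so
  that vanishing of a composite becomes an equation that can be rewritten.\<close>

definition zr :: "'o \<Rightarrow> 'o \<Rightarrow> 'm" where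
  "zr X Y = (THE f. f \<in> Hom X Y \<and> zero_mor C f)"

lemma zr_props:
  assumes "X \<in> c_obj C" "Y \<in> c_obj C"
  shows "zr X Y \<in> Hom X Y \<and> zero_mor C (zr X Y)"
proof -
  obtain Z\<^sub>0 where Z\<^sub>0: "zero_obj C Z\<^sub>0" by (rule zero_obj_ex)
  obtain f g where fg: "f \<in> Hom X Z\<^sub>0" "g \<in> Hom Z\<^sub>0 Y"
    using zero_objD(2,3)[OF Z\<^sub>0] assms by blast
  have gf: "g \<cdot> f \<in> Hom X Y" using fg by (rule comp_hom)
  have zero: "zero_mor C (g \<cdot> f)"
    unfolding zero_mor_def hom_arr(2,3)[OF gf]
    using Z\<^sub>0 fg hom_arr(1)[OF gf] by blast
  have "\<exists>!f. f \<in> Hom X Y \<and> zero_mor C f"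
    using gf zero zero_mor_unique by blast
  then show ?thesis unfolding zr_def by (rule theI')
qed

lemma zr_hom: "X \<in> c_obj C \<Longrightarrow> Y \<in> c_obj C \<Longrightarrow> zr X Y \<in> Hom X Y"
  by (simp add: zr_props)

lemma zero_mor_iff: "f \<in> Hom X Y \<Longrightarrow> zero_mor C f \<longleftrightarrow> f = zr X Y"
  using zr_props zero_mor_unique hom_obj by metis

lemma comp_zr:
  assumes "g \<in> Hom Y Z" "X \<in> c_obj C"
  shows "g \<cdot> zr X Y = zr X Z"
proof -
  have z: "zr X Y \<in> Hom X Y" "zero_mor C (zr X Y)" "g \<cdot> zr X Y \<in> Hom X Z"
    using assms zr_props hom_obj comp_hom by metis+
  then obtain Z\<^sub>0 f1 f2 where f: "zero_obj C Z\<^sub>0" "f1 \<in> Hom X Z\<^sub>0" "f2 \<in> Hom Z\<^sub>0 Y" "zr X Y = f2 \<cdot> f1"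
    unfolding zero_mor_def hom_def by auto
  have "zero_mor C (g \<cdot> zr X Y)"
    unfolding zero_mor_def hom_arr(2,3)[OF z(3)]
    using f comp_assoc[OF f(2,3) assms(1)] comp_hom[OF f(3) assms(1)] hom_arr(1)[OF z(3)] by metis
  with z show ?thesis by (simp add: zero_mor_iff)
qed

text \<open>The opposite category carries its own copy of \<open>zr\<close>; rewriting it back is
  what lets dualised kernel lemmas be read as cokernel lemmas.\<close>

lemma zr_op_cat: "X \<in> c_obj C \<Longrightarrow> Y \<in> c_obj C \<Longrightarrow> abelian_category.zr (op_cat C) X Y = zr Y X"
  using abelian_category.zr_props[OF dual, of X Y] zero_mor_iff[of "abelian_category.zr (op_cat C) X Y" Y X]
  by simp

lemma zr_comp: "f \<in> Hom X Y \<Longrightarrow> Z \<in> c_obj C \<Longrightarrow> zr Y Z \<cdot> f = zr X Z"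
  using abelian_category.comp_zr[OF dual, of f Y X Z] zr_op_cat hom_obj by simp

section \<open>Monomorphisms, epimorphisms, kernels and cokernels\<close>

lemma monoD: "mono C f \<Longrightarrow> f \<in> Hom X Y \<Longrightarrow> a \<in> Hom T X \<Longrightarrow> b \<in> Hom T X \<Longrightarrow> f \<cdot> a = f \<cdot> b \<Longrightarrow> a = b"
  by (auto simp: mono_def hom_def)

lemma epiD: "epi C f \<Longrightarrow> f \<in> Hom X Y \<Longrightarrow> a \<in> Hom Y T \<Longrightarrow> b \<in> Hom Y T \<Longrightarrow> a \<cdot> f = b \<cdot> f \<Longrightarrow> a = b"
  by (auto simp: epi_def hom_def)

lemma monoI:
  assumes "f \<in> Hom X Y" "\<And>T a b. a \<in> Hom T X \<Longrightarrow> b \<in> Hom T X \<Longrightarrow> f \<cdot> a = f \<cdot> b \<Longrightarrow> a = b"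
  shows "mono C f"
  using assms by (auto simp: mono_def hom_def)

lemma kernelD:
  assumes "is_kernel C f k" "f \<in> Hom Y Z" "k \<in> Hom X Y"
  shows "f \<cdot> k = zr X Z" "mono C k"
    "\<And>T t. t \<in> Hom T Y \<Longrightarrow> f \<cdot> t = zr T Z \<Longrightarrow> \<exists>u\<in>Hom T X. k \<cdot> u = t"
proof -
  show 1: "f \<cdot> k = zr X Z"
    using assms zero_mor_iff[OF comp_hom[OF assms(3,2)]] by (simp add: is_kernel_def)
  have lift: "\<exists>!u. u \<in> Hom T X \<and> k \<cdot> u = t" if t: "t \<in> Hom T Y" "f \<cdot> t = zr T Z" for T t
  proof -
    have "zero_mor C (f \<cdot> t)"
      using t zero_mor_iff[OF comp_hom[OF t(1) assms(2)]] by simp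
    moreover have "\<And>g. g \<in> c_arr C \<and> c_cod C g = c_dom C f \<and> zero_mor C (f \<cdot> g) \<longrightarrow>
        (\<exists>!u. u \<in> Hom (c_dom C g) (c_dom C k) \<and> k \<cdot> u = g)"
      using assms(1) by (simp add: is_kernel_def)
    from this[of t] calculation show ?thesis
      using hom_arr[OF t(1)] hom_arr[OF assms(2)] hom_arr[OF assms(3)] by simp
  qed
  then show "\<And>T t. t \<in> Hom T Y \<Longrightarrow> f \<cdot> t = zr T Z \<Longrightarrow> \<exists>u\<in>Hom T X. k \<cdot> u = t" by blast
  show "mono C k"
  proof (rule monoI[OF assms(3)])
    fix T a b assume ab: "a \<in> Hom T X" "b \<in> Hom T X" "k \<cdot> a = k \<cdot> b"
    have "f \<cdot> k \<cdot> b = zr T Z"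
      using comp_assoc[OF ab(2) assms(3,2)] 1 zr_comp[OF ab(2)] hom_obj(2)[OF assms(2)] by simp
    then show "a = b" using lift[OF comp_hom[OF ab(2) assms(3)]] ab by auto
  qed
qed

lemma kernelI:
  assumes "f \<in> Hom Y Z" "k \<in> Hom X Y" "f \<cdot> k = zr X Z" "mono C k"
    "\<And>T t. t \<in> Hom T Y \<Longrightarrow> f \<cdot> t = zr T Z \<Longrightarrow> \<exists>u\<in>Hom T X. k \<cdot> u = t"
  shows "is_kernel C f k"
  unfolding is_kernel_def
proof (intro conjI allI impI)
  show "zero_mor C (f \<cdot> k)" using zero_mor_iff[OF comp_hom[OF assms(2,1)]] assms(3) by simp
  fix g assume g: "g \<in> c_arr C \<and> c_cod C g = c_dom C f \<and> zero_mor C (f \<cdot> g)"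
  then have g': "g \<in> Hom (c_dom C g) Y" using hom_arr[OF assms(1)] by (simp add: hom_def)
  then have "f \<cdot> g = zr (c_dom C g) Z" using g zero_mor_iff[OF comp_hom[OF g' assms(1)]] by simp
  then obtain u where "u \<in> Hom (c_dom C g) X" "k \<cdot> u = g" using assms(5) g' by blast
  then show "\<exists>!u. u \<in> Hom (c_dom C g) (c_dom C k) \<and> k \<cdot> u = g"
    using hom_arr[OF assms(2)] monoD[OF assms(4,2)] by auto
qed (use hom_arr assms(1,2) in auto)

lemma cokernelD:
  assumes "is_cokernel C f c" "f \<in> Hom X Y" "c \<in> Hom Y Z"
  shows "c \<cdot> f = zr X Z" "epi C c"
    "\<And>T t. t \<in> Hom Y T \<Longrightarrow> t \<cdot> f = zr X T \<Longrightarrow> \<exists>u\<in>Hom Z T. u \<cdot> c = t"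
  using abelian_category.kernelD[OF dual, of f c] assms zr_op_cat hom_obj by simp_all

lemma cokernelI:
  assumes "f \<in> Hom X Y" "c \<in> Hom Y Z" "c \<cdot> f = zr X Z" "epi C c"
    "\<And>T t. t \<in> Hom Y T \<Longrightarrow> t \<cdot> f = zr X T \<Longrightarrow> \<exists>u\<in>Hom Z T. u \<cdot> c = t"
  shows "is_cokernel C f c"
  using abelian_category.kernelI[OF dual, of f Y X c Z] assms zr_op_cat hom_obj by simp

lemma kernel_ex:
  assumes "f \<in> Hom Y Z"
  obtains X k where "k \<in> Hom X Y" "is_kernel C f k"
proof -
  obtain k where k: "is_kernel C f k"
    using abelian_axioms(3) hom_arr[OF assms] by blast
  then have "k \<in> Hom (c_dom C k) Y" using hom_arr[OF assms] by (simp add: is_kernel_def hom_def)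
  then show thesis using k that by blast
qed

lemma cokernel_ex:
  assumes "f \<in> Hom X Y"
  obtains Z c where "c \<in> Hom Y Z" "is_cokernel C f c"
  by (rule abelian_category.kernel_ex[OF dual, of f Y X, simplified]) (use assms that in auto)

lemma comp_mono_left:
  assumes "f \<in> Hom X Y" "g \<in> Hom Y Z" "mono C (g \<cdot> f)"
  shows "mono C f"
proof (rule monoI[OF assms(1)])
  fix T a b assume h: "a \<in> Hom T X" "b \<in> Hom T X" "f \<cdot> a = f \<cdot> b"
  then have "(g \<cdot> f) \<cdot> a = (g \<cdot> f) \<cdot> b"
    using comp_assoc[OF h(1) assms(1,2)] comp_assoc[OF h(2) assms(1,2)] by simp
  then show "a = b" using monoD[OF assms(3) comp_hom[OF assms(1,2)] h(1,2)] by blast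
qed

lemma mono_comp:
  assumes "f \<in> Hom X Y" "g \<in> Hom Y Z" "mono C f" "mono C g"
  shows "mono C (g \<cdot> f)"
proof (rule monoI[OF comp_hom[OF assms(1,2)]])
  fix T a b assume h: "a \<in> Hom T X" "b \<in> Hom T X" "(g \<cdot> f) \<cdot> a = (g \<cdot> f) \<cdot> b"
  then have "g \<cdot> f \<cdot> a = g \<cdot> f \<cdot> b" using assms comp_assoc by metis
  then have "f \<cdot> a = f \<cdot> b" using h monoD[OF assms(4,2)] comp_hom assms(1) by metis
  then show "a = b" using h monoD[OF assms(3,1)] by blast
qed

lemma comp_epi_right: "f \<in> Hom X Y \<Longrightarrow> g \<in> Hom Y Z \<Longrightarrow> epi C (g \<cdot> f) \<Longrightarrow> epi C g"
  using abelian_category.comp_mono_left[OF dual, of g Z Y f X] by simp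

lemma epi_comp: "f \<in> Hom X Y \<Longrightarrow> g \<in> Hom Y Z \<Longrightarrow> epi C f \<Longrightarrow> epi C g \<Longrightarrow> epi C (g \<cdot> f)"
  using abelian_category.mono_comp[OF dual, of g Z Y f X] by simp

lemma split_mono:
  assumes "f \<in> Hom X Y" "r \<in> Hom Y X" "r \<cdot> f = \<one> X"
  shows "mono C f"
proof (rule monoI[OF assms(1)])
  fix T a b assume h: "a \<in> Hom T X" "b \<in> Hom T X" "f \<cdot> a = f \<cdot> b"
  then show "a = b"
    using comp_assoc[OF h(1) assms(1,2)] comp_assoc[OF h(2) assms(1,2)] assms(3) id_comp by metis
qed

lemma split_epi: "g \<in> Hom Y Z \<Longrightarrow> s \<in> Hom Z Y \<Longrightarrow> g \<cdot> s = \<one> Z \<Longrightarrow> epi C g"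
  using abelian_category.split_mono[OF dual, of g Z Y s] by simp

lemma mono_is_kernel:
  assumes "mono C f" "f \<in> Hom X Y"
  obtains g Z where "g \<in> Hom Y Z" "is_kernel C g f"
proof -
  obtain g where g: "is_kernel C g f" using abelian_axioms(4) assms by blast
  then have "g \<in> Hom Y (c_cod C g)" using hom_arr[OF assms(2)] by (simp add: is_kernel_def hom_def)
  with g that show thesis by blast
qed

text \<open>The mono \<open>f\<close> is the kernel of some \<open>h\<close>, and \<open>f\<close>
  being epi forces \<open>h\<close> to be zero. Hence the identity of \<open>Y\<close> lifts through
  \<open>f\<close>; this right inverse is two-sided because \<open>f\<close> is mono.\<close>

lemma mono_epi_iso:
  assumes "mono C f" "epi C f" "f \<in> Hom X Y"
  obtains g where "g \<in> Hom Y X" "g \<cdot> f = \<one> X" "f \<cdot> g = \<one> Y"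
proof -
  obtain h Z where h: "h \<in> Hom Y Z" "is_kernel C h f"
    using mono_is_kernel assms by blast
  have obj: "X \<in> c_obj C" "Y \<in> c_obj C" "Z \<in> c_obj C" using h assms hom_obj by blast+
  have "h \<cdot> f = zr Y Z \<cdot> f"
    using kernelD(1)[OF h(2,1) assms(3)] zr_comp[OF assms(3) obj(3)] by simp
  then have "h = zr Y Z" using epiD[OF assms(2,3) h(1)] zr_hom obj by blast
  then have "h \<cdot> \<one> Y = zr Y Z" using zr_comp id_hom obj by metis
  then obtain g where g: "g \<in> Hom Y X" "f \<cdot> g = \<one> Y"
    using kernelD(3)[OF h(2,1) assms(3) id_hom[OF obj(2)]] by blast
  have "f \<cdot> g \<cdot> f = f \<cdot> \<one> X"
    using g assms(3) comp_assoc id_comp comp_id by metis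
  then have "g \<cdot> f = \<one> X"
    using monoD[OF assms(1,3) comp_hom[OF assms(3) g(1)] id_hom[OF obj(1)]] by blast
  with g that show thesis by blast
qed

text \<open>Being mono, \<open>f\<close> is the kernel of some \<open>g\<close>, which factors
  through the cokernel \<open>c\<close>. So whatever \<open>c\<close> kills, \<open>g\<close> kills
  too, and it lifts through \<open>f\<close>.\<close>

lemma mono_kernel_of_cokernel:
  assumes "mono C f" "is_cokernel C f c" "f \<in> Hom X Y" "c \<in> Hom Y Z"
  shows "is_kernel C c f"
proof (rule kernelI[OF assms(4,3) _ assms(1)])
  show "c \<cdot> f = zr X Z" using cokernelD assms by blast
  fix T t assume t: "t \<in> Hom T Y" "c \<cdot> t = zr T Z"
  obtain g Z' where g: "g \<in> Hom Y Z'" "is_kernel C g f"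
    using mono_is_kernel assms by blast
  then obtain u where u: "u \<in> Hom Z Z'" "u \<cdot> c = g"
    using cokernelD(3)[OF assms(2-4)] kernelD(1) assms(3) by blast
  have "g \<cdot> t = zr T Z'"
    using u t comp_assoc[OF t(1) assms(4) u(1)] comp_zr hom_obj by metis
  then show "\<exists>u\<in>Hom T X. f \<cdot> u = t" using kernelD(3)[OF g(2,1) assms(3)] t by blast
qed

lemma epi_cokernel_of_kernel:
  "epi C g \<Longrightarrow> is_kernel C g k \<Longrightarrow> k \<in> Hom X Y \<Longrightarrow> g \<in> Hom Y Z \<Longrightarrow> is_cokernel C k g"
  using abelian_category.mono_kernel_of_cokernel[OF dual, of g k Z Y X] by simp

section \<open>Products, equalizers, and testing monos on zero\<close>

lemma product_ex:
  assumes "A \<in> c_obj C" "B \<in> c_obj C"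
  obtains P p q where "is_product C A B P p q"
  using abelian_axioms(2) assms by blast

lemma coproduct_ex:
  assumes "A \<in> c_obj C" "B \<in> c_obj C"
  obtains P p q where "is_coproduct C A B P p q"
  using abelian_axioms(2) assms by blast

lemma productD:
  assumes "is_product C A B P p q"
  shows "p \<in> Hom P A" "q \<in> Hom P B"
    "\<And>T f g. f \<in> Hom T A \<Longrightarrow> g \<in> Hom T B \<Longrightarrow> \<exists>u\<in>Hom T P. p \<cdot> u = f \<and> q \<cdot> u = g"
    "\<And>T u v. u \<in> Hom T P \<Longrightarrow> v \<in> Hom T P \<Longrightarrow> p \<cdot> u = p \<cdot> v \<Longrightarrow> q \<cdot> u = q \<cdot> v \<Longrightarrow> u = v"
proof -
  show pq: "p \<in> Hom P A" "q \<in> Hom P B" using assms by (auto simp: is_product_def)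
  have *: "\<exists>!u. u \<in> Hom T P \<and> p \<cdot> u = f \<and> q \<cdot> u = g" if "f \<in> Hom T A" "g \<in> Hom T B" for T f g
    using assms that by (simp add: is_product_def)
  then show "\<And>T f g. f \<in> Hom T A \<Longrightarrow> g \<in> Hom T B \<Longrightarrow> \<exists>u\<in>Hom T P. p \<cdot> u = f \<and> q \<cdot> u = g"
    by blast
  fix T u v assume "u \<in> Hom T P" "v \<in> Hom T P" "p \<cdot> u = p \<cdot> v" "q \<cdot> u = q \<cdot> v"
  then show "u = v" using *[of "p \<cdot> u" T "q \<cdot> u"] comp_hom pq by metis
qed

lemma coproductD:
  assumes "is_coproduct C A B S i j"
  shows "i \<in> Hom A S" "j \<in> Hom B S"
    "\<And>T f g. f \<in> Hom A T \<Longrightarrow> g \<in> Hom B T \<Longrightarrow> \<exists>u\<in>Hom S T. u \<cdot> i = f \<and> u \<cdot> j = g"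
    "\<And>T u v. u \<in> Hom S T \<Longrightarrow> v \<in> Hom S T \<Longrightarrow> u \<cdot> i = v \<cdot> i \<Longrightarrow> u \<cdot> j = v \<cdot> j \<Longrightarrow> u = v"
  using abelian_category.productD[OF dual, of A B S i j] assms by simp_all

text \<open>The equalizer of \<open>u\<close> and \<open>v\<close> is the intersection of their graphs inside the product.\<close>

lemma equalizer_ex:
  assumes "u \<in> Hom A B" "v \<in> Hom A B"
  obtains K k where "k \<in> Hom K A" "mono C k" "u \<cdot> k = v \<cdot> k"
    "\<And>T t. t \<in> Hom T A \<Longrightarrow> u \<cdot> t = v \<cdot> t \<Longrightarrow> \<exists>w\<in>Hom T K. k \<cdot> w = t"
proof -
  have obj: "A \<in> c_obj C" "B \<in> c_obj C" using assms hom_obj by blast+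
  then obtain P p q where "is_product C A B P p q" by (rule product_ex)
  note P = productD[OF this]
  obtain a where a: "a \<in> Hom A P" "p \<cdot> a = \<one> A" "q \<cdot> a = u"
    using P(3)[OF id_hom] obj assms by blast
  obtain b where b: "b \<in> Hom A P" "p \<cdot> b = \<one> A" "q \<cdot> b = v"
    using P(3)[OF id_hom] obj assms by blast
  have mono_a: "mono C a" using split_mono a P by blast
  \<comment> \<open>The graph \<open>a\<close> of \<open>u\<close> is the kernel of its cokernel
    \<open>c\<close>. The kernel of \<open>c \<cdot> b\<close> is therefore the part of
    \<open>A\<close> over which the graph \<open>b\<close> of \<open>v\<close> lies inside the graph
    of \<open>u\<close>.\<close>
  obtain D c where c: "c \<in> Hom P D" "is_cokernel C a c" using cokernel_ex a by blast
  have ker: "is_kernel C c a" using mono_kernel_of_cokernel mono_a c a by blast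
  have cb: "c \<cdot> b \<in> Hom A D" using b c comp_hom by blast
  then obtain K k where k: "k \<in> Hom K A" "is_kernel C (c \<cdot> b) k" using kernel_ex by blast
  have "c \<cdot> b \<cdot> k = zr K D" using kernelD(1)[OF k(2) cb k(1)] comp_assoc[OF k(1) b(1) c(1)] by simp
  then obtain l where l: "l \<in> Hom K A" "a \<cdot> l = b \<cdot> k"
    using kernelD(3)[OF ker c(1) a(1)] comp_hom[OF k(1) b(1)] by blast
  \<comment> \<open>The first projection of \<open>a \<cdot> l = b \<cdot> k\<close> gives
    \<open>l = k\<close>; the second projection then gives the equalizer equation.\<close>
  have "l = k"
    using l k a b P comp_assoc[OF l(1) a(1) P(1)] comp_assoc[OF k(1) b(1) P(1)] id_comp by metis
  then have "u \<cdot> k = v \<cdot> k"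
    using l a b comp_assoc[OF k(1) a(1) P(2)] comp_assoc[OF k(1) b(1) P(2)] by metis
  moreover have "\<exists>w\<in>Hom T K. k \<cdot> w = t" if t: "t \<in> Hom T A" "u \<cdot> t = v \<cdot> t" for T t
  proof -
    have "b \<cdot> t = a \<cdot> t"
    proof (rule P(4))
      show "b \<cdot> t \<in> Hom T P" "a \<cdot> t \<in> Hom T P" using t a b comp_hom by blast+
      show "p \<cdot> b \<cdot> t = p \<cdot> a \<cdot> t" "q \<cdot> b \<cdot> t = q \<cdot> a \<cdot> t"
        using t(2) a b comp_assoc[OF t(1) a(1) P(1)] comp_assoc[OF t(1) b(1) P(1)]
          comp_assoc[OF t(1) a(1) P(2)] comp_assoc[OF t(1) b(1) P(2)] by simp_all
    qed
    then have "(c \<cdot> b) \<cdot> t = (c \<cdot> a) \<cdot> t"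
      using comp_assoc[OF t(1) a(1) c(1)] comp_assoc[OF t(1) b(1) c(1)] by simp
    also have "\<dots> = zr T D"
      using cokernelD(1)[OF c(2) a(1) c(1)] zr_comp[OF t(1)] hom_obj c by metis
    finally show ?thesis using kernelD(3)[OF k(2) cb k(1)] t by blast
  qed
  ultimately show thesis using that k kernelD(2)[OF k(2) cb k(1)] by blast
qed

lemma coequalizer_ex:
  assumes "u \<in> Hom A B" "v \<in> Hom A B"
  obtains K k where "k \<in> Hom B K" "epi C k" "k \<cdot> u = k \<cdot> v"
    "\<And>T t. t \<in> Hom B T \<Longrightarrow> t \<cdot> u = t \<cdot> v \<Longrightarrow> \<exists>w\<in>Hom K T. w \<cdot> k = t"
  by (rule abelian_category.equalizer_ex[OF dual, of u B A v, simplified]) (use assms that in auto)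

text \<open>A replacement for passing to \<open>a - b\<close>: factor \<open>f\<close> through the
  coequalizer \<open>k\<close> of \<open>a\<close> and \<open>b\<close>. The kernel of
  \<open>k\<close> is killed by \<open>f\<close>, hence zero; the epi \<open>k\<close> is the
  cokernel of this zero kernel, so the identity of \<open>X\<close> factors through it. Thus
  \<open>k\<close> is mono and \<open>k \<cdot> a = k \<cdot> b\<close> cancels.\<close>

lemma mono_if_kernel_zero:
  assumes f: "f \<in> Hom X Y" and "\<And>T t. t \<in> Hom T X \<Longrightarrow> f \<cdot> t = zr T Y \<Longrightarrow> t = zr T X"
  shows "mono C f"
proof (rule monoI[OF f])
  fix T a b assume ab: "a \<in> Hom T X" "b \<in> Hom T X" "f \<cdot> a = f \<cdot> b"
  obtain K k where k: "k \<in> Hom X K" "epi C k" "k \<cdot> a = k \<cdot> b"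
    and kf: "\<exists>w\<in>Hom K Y. w \<cdot> k = f"
    using coequalizer_ex[OF ab(1,2)] ab f by metis
  obtain w where w: "w \<in> Hom K Y" "w \<cdot> k = f" using kf by blast
  obtain L l where l: "l \<in> Hom L X" "is_kernel C k l" using kernel_ex k by blast
  have obj: "L \<in> c_obj C" "X \<in> c_obj C" using l hom_obj by blast+
  have "f \<cdot> l = zr L Y"
    using kernelD(1)[OF l(2) k(1) l(1)] comp_assoc[OF l(1) k(1) w(1)] w comp_zr obj by metis
  then have "l = zr L X" using assms(2) l by blast
  then have "\<one> X \<cdot> l = zr L X" using id_comp l by metis
  moreover have "is_cokernel C l k" using epi_cokernel_of_kernel k l by blast
  ultimately obtain s where "s \<in> Hom K X" "s \<cdot> k = \<one> X"
    using cokernelD(3)[OF _ l(1) k(1) id_hom] obj by blast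
  then have "mono C k" using split_mono k by blast
  then show "a = b" using monoD k ab by blast
qed

lemma epi_if_cokernel_zero:
  assumes "f \<in> Hom X Y" and "\<And>T t. t \<in> Hom Y T \<Longrightarrow> t \<cdot> f = zr X T \<Longrightarrow> t = zr Y T"
  shows "epi C f"
  using abelian_category.mono_if_kernel_zero[OF dual, of f Y X] assms zr_op_cat hom_obj by simp


subsection \<open>Short exact sequences\<close>

text \<open>The right-hand side is visibly self-dual, while \<open>exact_at\<close> is phrased with
  kernels only.\<close>

lemma short_exact_iff:
  "short_exact C X Y Z f g \<longleftrightarrow>
     f \<in> Hom X Y \<and> g \<in> Hom Y Z \<and> is_kernel C g f \<and> is_cokernel C f g"
proof
  assume se: "short_exact C X Y Z f g"
  then have fg: "f \<in> Hom X Y" "g \<in> Hom Y Z" and mono_f: "mono C f" and epi_g: "epi C g"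
    by (auto simp: short_exact_def)
  obtain k u where ku: "is_kernel C g k" "u \<in> Hom X (c_dom C k)" "k \<cdot> u = f" "epi C u"
    using se hom_arr[OF fg(1)] by (auto simp: short_exact_def exact_at_def)
  define K where "K = c_dom C k"
  have k: "k \<in> Hom K Y" using ku(1) hom_arr[OF fg(2)] by (simp add: is_kernel_def hom_def K_def)
  have u: "u \<in> Hom X K" using ku(2) by (simp add: K_def)
  \<comment> \<open>The comparison \<open>u\<close> from \<open>X\<close> to the kernel provided by
    exactness is epi, and mono because \<open>f\<close> is; being invertible, it makes
    \<open>f\<close> itself a kernel.\<close>
  have "mono C u" using comp_mono_left[OF u k] ku(3) mono_f by simp
  then obtain v where v: "v \<in> Hom K X" "u \<cdot> v = \<one> K" using mono_epi_iso ku(4) u by blast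
  have ker: "is_kernel C g f"
  proof (rule kernelI[OF fg(2,1) _ mono_f])
    show "g \<cdot> f = zr X Z"
      using se zero_mor_iff[OF comp_hom[OF fg]] by (simp add: short_exact_def exact_at_def)
    fix T t assume t: "t \<in> Hom T Y" "g \<cdot> t = zr T Z"
    then obtain w where w: "w \<in> Hom T K" "k \<cdot> w = t" using kernelD(3)[OF ku(1) fg(2) k] by blast
    have "f \<cdot> v \<cdot> w = k \<cdot> u \<cdot> v \<cdot> w"
      using comp_assoc[OF comp_hom[OF w(1) v(1)] u k] ku(3) by simp
    also have "\<dots> = t" using comp_assoc[OF w(1) v(1) u] v w id_comp by simp
    finally show "\<exists>u\<in>Hom T X. f \<cdot> u = t" using comp_hom[OF w(1) v(1)] by blast
  qed
  then show "f \<in> Hom X Y \<and> g \<in> Hom Y Z \<and> is_kernel C g f \<and> is_cokernel C f g"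
    using fg epi_cokernel_of_kernel[OF epi_g] by blast
next
  assume h: "f \<in> Hom X Y \<and> g \<in> Hom Y Z \<and> is_kernel C g f \<and> is_cokernel C f g"
  then have fg: "f \<in> Hom X Y" "g \<in> Hom Y Z" by auto
  have "mono C f" "epi C g" using h kernelD(2) cokernelD(2) fg by blast+
  moreover have "epi C (\<one> X)"
    using split_epi[of "\<one> X" X X "\<one> X"] comp_id id_hom hom_obj(1)[OF fg(1)] by blast
  moreover have "zero_mor C (g \<cdot> f)" using h by (simp add: is_kernel_def)
  ultimately show "short_exact C X Y Z f g"
    unfolding short_exact_def exact_at_def
    using h hom_arr[OF fg(1)] hom_arr[OF fg(2)] comp_id[OF fg(1)] id_hom[OF hom_obj(1)[OF fg(1)]]
    by auto
qed

lemma short_exactD: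
  assumes "short_exact C X Y Z f g"
  shows "f \<in> Hom X Y" "g \<in> Hom Y Z" "g \<cdot> f = zr X Z" "mono C f" "epi C g"
    "\<And>T t. t \<in> Hom T Y \<Longrightarrow> g \<cdot> t = zr T Z \<Longrightarrow> \<exists>u\<in>Hom T X. f \<cdot> u = t"
    "\<And>T t. t \<in> Hom Y T \<Longrightarrow> t \<cdot> f = zr X T \<Longrightarrow> \<exists>u\<in>Hom Z T. u \<cdot> g = t"
    "X \<in> c_obj C" "Y \<in> c_obj C" "Z \<in> c_obj C"
proof -
  have fg: "f \<in> Hom X Y" "g \<in> Hom Y Z" and ker: "is_kernel C g f" and coker: "is_cokernel C f g"
    using assms by (auto simp: short_exact_iff)
  show "f \<in> Hom X Y" "g \<in> Hom Y Z" by (fact fg)+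
  show "X \<in> c_obj C" "Y \<in> c_obj C" "Z \<in> c_obj C" using fg hom_obj by blast+
  show "g \<cdot> f = zr X Z" "mono C f"
    "\<And>T t. t \<in> Hom T Y \<Longrightarrow> g \<cdot> t = zr T Z \<Longrightarrow> \<exists>u\<in>Hom T X. f \<cdot> u = t"
    using kernelD[OF ker fg(2,1)] by blast+
  show "epi C g"
    "\<And>T t. t \<in> Hom Y T \<Longrightarrow> t \<cdot> f = zr X T \<Longrightarrow> \<exists>u\<in>Hom Z T. u \<cdot> g = t"
    using cokernelD[OF coker fg] by blast+
qed

lemma short_exact_op_cat: "short_exact (op_cat C) Z Y X g f \<longleftrightarrow> short_exact C X Y Z f g"
  by (auto simp: short_exact_iff abelian_category.short_exact_iff[OF dual])

lemma short_exactI: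
  assumes "f \<in> Hom X Y" "g \<in> Hom Y Z" "g \<cdot> f = zr X Z" "mono C f" "epi C g"
    "\<And>T t. t \<in> Hom T Y \<Longrightarrow> g \<cdot> t = zr T Z \<Longrightarrow> \<exists>u\<in>Hom T X. f \<cdot> u = t"
  shows "short_exact C X Y Z f g"
proof -
  have "is_kernel C g f" using assms by (intro kernelI)
  then show ?thesis using assms epi_cokernel_of_kernel by (auto simp: short_exact_iff)
qed

lemma short_exactI':
  assumes "f \<in> Hom X Y" "g \<in> Hom Y Z" "g \<cdot> f = zr X Z" "mono C f" "epi C g"
    "\<And>T t. t \<in> Hom Y T \<Longrightarrow> t \<cdot> f = zr X T \<Longrightarrow> \<exists>u\<in>Hom Z T. u \<cdot> g = t"
  shows "short_exact C X Y Z f g"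
proof -
  have "is_cokernel C f g" using assms by (intro cokernelI)
  then show ?thesis using assms mono_kernel_of_cokernel by (auto simp: short_exact_iff)
qed

text \<open>Whatever \<open>h\<close> kills is killed by \<open>g\<close>, hence comes from
  \<open>X\<close>, on which \<open>h\<close> acts as the mono \<open>f'\<close>.\<close>

lemma short_five_mono:
  assumes "short_exact C X Y Z f g" "h \<in> Hom Y Y'" "f' \<in> Hom X Y'" "mono C f'"
    "g' \<in> Hom Y' Z" "h \<cdot> f = f'" "g' \<cdot> h = g"
  shows "mono C h"
proof (rule mono_if_kernel_zero[OF assms(2)])
  note se = short_exactD[OF assms(1)]
  fix T t assume t: "t \<in> Hom T Y" "h \<cdot> t = zr T Y'"
  have T: "T \<in> c_obj C" using t hom_obj by blast
  have "g \<cdot> t = g' \<cdot> zr T Y'" using comp_assoc[OF t(1) assms(2,5)] assms(7) t(2) by simp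
  then obtain u where u: "u \<in> Hom T X" "f \<cdot> u = t"
    using se(6)[OF t(1)] comp_zr[OF assms(5) T] by auto
  have "f' \<cdot> u = zr T Y'" using comp_assoc[OF u(1) se(1) assms(2)] u t assms(6) by simp
  then have "f' \<cdot> u = f' \<cdot> zr T X" using comp_zr[OF assms(3) T] by simp
  then have "u = zr T X" using monoD[OF assms(4,3) u(1)] zr_hom[OF T se(8)] by blast
  then show "t = zr T Y" using u comp_zr[OF se(1) T] by simp
qed

lemma short_five_epi:
  assumes "short_exact C X Y Z f g" "h \<in> Hom Y' Y" "f' \<in> Hom X Y'" "epi C g'"
    "g' \<in> Hom Y' Z" "h \<cdot> f' = f" "g \<cdot> h = g'"
  shows "epi C h"
  using abelian_category.short_five_mono[OF dual, of Z Y X g f h Y' g' f'] assms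
  by (simp add: short_exact_op_cat)

lemma short_five:
  assumes "short_exact C X Y Z f g" "short_exact C X Y' Z f' g'" "h \<in> Hom Y Y'"
    "h \<cdot> f = f'" "g' \<cdot> h = g"
  obtains h' where "h' \<in> Hom Y' Y" "h' \<cdot> h = \<one> Y" "h \<cdot> h' = \<one> Y'"
proof -
  note se = short_exactD[OF assms(1)] and se' = short_exactD[OF assms(2)]
  have "mono C h" using short_five_mono[OF assms(1,3) se'(1,4,2)] assms by blast
  moreover have "epi C h" using short_five_epi[OF assms(2,3) se(1,5,2)] assms by blast
  ultimately show thesis using mono_epi_iso assms(3) that by blast
qed

text \<open>Projections arise from the universal property applied to identities and zeros. A map
  \<open>t\<close> killing \<open>i\<close> equals \<open>(t \<cdot> j) \<cdot> q\<close>, as both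
  agree on the two injections; so \<open>q\<close> is the cokernel of \<open>i\<close>.\<close>

lemma coproduct_short_exact:
  assumes "is_coproduct C A B S i j"
  obtains p q where "p \<in> Hom S A" "q \<in> Hom S B" "p \<cdot> i = \<one> A" "p \<cdot> j = zr B A"
    "q \<cdot> i = zr A B" "q \<cdot> j = \<one> B" "short_exact C A S B i q"
proof -
  note S = coproductD[OF assms]
  have obj: "A \<in> c_obj C" "B \<in> c_obj C" using S hom_obj by blast+
  obtain p where p: "p \<in> Hom S A" "p \<cdot> i = \<one> A" "p \<cdot> j = zr B A"
    using S(3)[OF id_hom zr_hom] obj by blast
  obtain q where q: "q \<in> Hom S B" "q \<cdot> i = zr A B" "q \<cdot> j = \<one> B"
    using S(3)[OF zr_hom id_hom] obj by blast
  have "short_exact C A S B i q"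
  proof (rule short_exactI'[OF S(1) q(1,2) split_mono[OF S(1) p(1,2)] split_epi[OF q(1) S(2) q(3)]])
    fix T t assume t: "t \<in> Hom S T" "t \<cdot> i = zr A T"
    have tj: "t \<cdot> j \<in> Hom B T" using comp_hom[OF S(2) t(1)] .
    have "(t \<cdot> j) \<cdot> q = t"
    proof (rule S(4)[OF comp_hom[OF q(1) tj] t(1)])
      show "((t \<cdot> j) \<cdot> q) \<cdot> i = t \<cdot> i"
        using comp_assoc[OF S(1) q(1) tj] q t comp_zr[OF tj obj(1)] by simp
      show "((t \<cdot> j) \<cdot> q) \<cdot> j = t \<cdot> j"
        using comp_assoc[OF S(2) q(1) tj] q comp_id[OF tj] by simp
    qed
    then show "\<exists>u\<in>Hom B T. u \<cdot> q = t" using tj by blast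
  qed
  with p q that show thesis by blast
qed

lemma product_short_exact:
  assumes "is_product C A B P p q"
  obtains i j where "i \<in> Hom A P" "j \<in> Hom B P" "p \<cdot> i = \<one> A" "q \<cdot> i = zr A B"
    "p \<cdot> j = zr B A" "q \<cdot> j = \<one> B" "short_exact C B P A j p"
proof -
  have "is_coproduct (op_cat C) A B P p q" using assms by simp
  then show thesis
  proof (rule abelian_category.coproduct_short_exact[OF dual])
    fix i j
    assume "i \<in> hom (op_cat C) P A" "j \<in> hom (op_cat C) P B"
      "c_comp (op_cat C) i p = c_id (op_cat C) A"
      "c_comp (op_cat C) i q = abelian_category.zr (op_cat C) B A"
      "c_comp (op_cat C) j p = abelian_category.zr (op_cat C) A B"
      "c_comp (op_cat C) j q = c_id (op_cat C) B" "short_exact (op_cat C) A P B p j"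
    then show thesis using that zr_op_cat hom_obj by (simp add: short_exact_op_cat)
  qed
qed

text \<open>The abstract coproduct \<open>S\<close> maps to \<open>Y\<close> compatibly with both
  short exact sequences, hence isomorphically by the short five lemma. The universal property is
  carried across this isomorphism.\<close>

lemma coproduct_if_section:
  assumes "short_exact C X Y Z f g" "s \<in> Hom Z Y" "g \<cdot> s = \<one> Z"
  shows "is_coproduct C X Z Y f s"
proof -
  note se = short_exactD[OF assms(1)]
  obtain S i j where S': "is_coproduct C X Z S i j" using coproduct_ex se(8,10) by blast
  note S = coproductD[OF S']
  obtain q where q: "q \<in> Hom S Z" "q \<cdot> i = zr X Z" "q \<cdot> j = \<one> Z"
    and se_q: "short_exact C X S Z i q"
    using coproduct_short_exact[OF S'] by blast
  obtain \<phi> where \<phi>: "\<phi> \<in> Hom S Y" "\<phi> \<cdot> i = f" "\<phi> \<cdot> j = s"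
    using S(3)[OF se(1) assms(2)] by blast
  have "g \<cdot> \<phi> = q"
  proof (rule S(4)[OF comp_hom[OF \<phi>(1) se(2)] q(1)])
    show "(g \<cdot> \<phi>) \<cdot> i = q \<cdot> i" using comp_assoc[OF S(1) \<phi>(1) se(2)] \<phi> q se(3) by simp
    show "(g \<cdot> \<phi>) \<cdot> j = q \<cdot> j" using comp_assoc[OF S(2) \<phi>(1) se(2)] \<phi> q assms(3) by simp
  qed
  then obtain \<psi> where \<psi>: "\<psi> \<in> Hom Y S" "\<psi> \<cdot> \<phi> = \<one> S" "\<phi> \<cdot> \<psi> = \<one> Y"
    using short_five[OF se_q assms(1) \<phi>(1,2)] by blast
  have \<psi>f: "\<psi> \<cdot> f = i" using comp_assoc[OF S(1) \<phi>(1) \<psi>(1)] \<phi> \<psi> id_comp[OF S(1)] by simp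
  have \<psi>s: "\<psi> \<cdot> s = j" using comp_assoc[OF S(2) \<phi>(1) \<psi>(1)] \<phi> \<psi> id_comp[OF S(2)] by simp
  show ?thesis
    unfolding is_coproduct_def
  proof (intro conjI allI impI)
    fix T a b assume ab: "a \<in> Hom X T \<and> b \<in> Hom Z T"
    then obtain u where u: "u \<in> Hom S T" "u \<cdot> i = a" "u \<cdot> j = b" using S(3) by blast
    show "\<exists>!u. u \<in> Hom Y T \<and> u \<cdot> f = a \<and> u \<cdot> s = b"
    proof (rule ex1I)
      show "u \<cdot> \<psi> \<in> Hom Y T \<and> (u \<cdot> \<psi>) \<cdot> f = a \<and> (u \<cdot> \<psi>) \<cdot> s = b"
        using comp_hom[OF \<psi>(1) u(1)] comp_assoc[OF se(1) \<psi>(1) u(1)] comp_assoc[OF assms(2) \<psi>(1) u(1)]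
          u \<psi>f \<psi>s by simp
      fix v assume v: "v \<in> Hom Y T \<and> v \<cdot> f = a \<and> v \<cdot> s = b"
      then have v': "v \<in> Hom Y T" by blast
      have "v \<cdot> \<phi> = u"
      proof (rule S(4)[OF comp_hom[OF \<phi>(1) v'] u(1)])
        show "(v \<cdot> \<phi>) \<cdot> i = u \<cdot> i" using comp_assoc[OF S(1) \<phi>(1) v'] \<phi> u v by simp
        show "(v \<cdot> \<phi>) \<cdot> j = u \<cdot> j" using comp_assoc[OF S(2) \<phi>(1) v'] \<phi> u v by simp
      qed
      then show "v = u \<cdot> \<psi>" using comp_assoc[OF \<psi>(1) \<phi>(1) v'] \<psi> comp_id[OF v'] by simp
    qed
  qed (use se assms in auto)
qed

text \<open>Instead of forming the identity minus \<open>s \<cdot> g\<close>, the retraction is read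
  off as a projection of the coproduct.\<close>

lemma section_imp_retraction:
  assumes "short_exact C X Y Z f g" "s \<in> Hom Z Y" "g \<cdot> s = \<one> Z"
  obtains r where "r \<in> Hom Y X" "r \<cdot> f = \<one> X"
  using coproduct_short_exact[OF coproduct_if_section[OF assms]] by blast

lemma retraction_imp_section:
  assumes "short_exact C X Y Z f g" "r \<in> Hom Y X" "r \<cdot> f = \<one> X"
  obtains s where "s \<in> Hom Z Y" "g \<cdot> s = \<one> Z"
  using abelian_category.section_imp_retraction[OF dual, of Z Y X g f r] assms
  by (auto simp: short_exact_op_cat)


subsection \<open>Pullbacks of epimorphisms\<close>

definition pullback :: "'o \<Rightarrow> 'o \<Rightarrow> 'o \<Rightarrow> 'm \<Rightarrow> 'm \<Rightarrow> 'o \<Rightarrow> 'm \<Rightarrow> 'm \<Rightarrow> bool" where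
  "pullback A B Z f g E p q \<longleftrightarrow>
     f \<in> Hom A Z \<and> g \<in> Hom B Z \<and> p \<in> Hom E A \<and> q \<in> Hom E B \<and> f \<cdot> p = g \<cdot> q \<and>
     (\<forall>T x y. x \<in> Hom T A \<and> y \<in> Hom T B \<and> f \<cdot> x = g \<cdot> y \<longrightarrow> (\<exists>u\<in>Hom T E. p \<cdot> u = x \<and> q \<cdot> u = y)) \<and>
     (\<forall>T u v. u \<in> Hom T E \<and> v \<in> Hom T E \<and> p \<cdot> u = p \<cdot> v \<and> q \<cdot> u = q \<cdot> v \<longrightarrow> u = v)"

lemma pullbackD:
  assumes "pullback A B Z f g E p q"
  shows "f \<in> Hom A Z" "g \<in> Hom B Z" "p \<in> Hom E A" "q \<in> Hom E B" "f \<cdot> p = g \<cdot> q"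
    "\<And>T x y. x \<in> Hom T A \<Longrightarrow> y \<in> Hom T B \<Longrightarrow> f \<cdot> x = g \<cdot> y \<Longrightarrow> \<exists>u\<in>Hom T E. p \<cdot> u = x \<and> q \<cdot> u = y"
    "\<And>T u v. u \<in> Hom T E \<Longrightarrow> v \<in> Hom T E \<Longrightarrow> p \<cdot> u = p \<cdot> v \<Longrightarrow> q \<cdot> u = q \<cdot> v \<Longrightarrow> u = v"
  using assms unfolding pullback_def by blast+

lemma pullback_sym: "pullback A B Z f g E p q \<Longrightarrow> pullback B A Z g f E q p"
  unfolding pullback_def by metis

text \<open>For a pullback along a subobject: the image of \<open>q\<close> and the whole of \<open>B\<close> have the same
  cokernel in \<open>P\<close>, hence coincide.\<close>

lemma epi_of_pullback_along_mono:
  assumes F: "F \<in> Hom Q P" "epi C F" and G: "G \<in> Hom B P" "mono C G"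
    and c: "c \<in> Hom P D" "is_cokernel C G c" and k: "k \<in> Hom E Q" "is_kernel C (c \<cdot> F) k"
    and q: "q \<in> Hom E B" "G \<cdot> q = F \<cdot> k"
  shows "epi C q"
proof (rule epi_if_cokernel_zero[OF q(1)])
  fix T t assume t: "t \<in> Hom B T" "t \<cdot> q = zr E T"
  \<comment> \<open>The kernel \<open>m\<close> of the cokernel \<open>w\<close> is the image of
    \<open>q\<close>. Since \<open>t\<close> factors through \<open>w\<close>, it suffices that
    \<open>w\<close> is zero.\<close>
  obtain W w where w: "w \<in> Hom B W" "is_cokernel C q w" using cokernel_ex q by blast
  obtain I m where m: "m \<in> Hom I B" "is_kernel C w m" using kernel_ex w by blast
  obtain e where e: "e \<in> Hom E I" "m \<cdot> e = q"
    using kernelD(3)[OF m(2) w(1) m(1) q(1)] cokernelD(1)[OF w(2) q(1) w(1)] by blast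
  have Gm: "G \<cdot> m \<in> Hom I P" using comp_hom[OF m(1) G(1)] .
  have cF: "c \<cdot> F \<in> Hom Q D" using comp_hom[OF F(1) c(1)] .
  have epi_c: "epi C c" using cokernelD(2)[OF c(2) G(1) c(1)] .
  have "epi C (c \<cdot> F)" using epi_comp F c epi_c by blast
  then have coker: "is_cokernel C k (c \<cdot> F)" using epi_cokernel_of_kernel k cF by blast
  have cG: "c \<cdot> G = zr B D" using cokernelD(1)[OF c(2) G(1) c(1)] .
  \<comment> \<open>A map \<open>s\<close> killing \<open>G \<cdot> m\<close> kills
    \<open>F \<cdot> k\<close>, so \<open>s \<cdot> F\<close> factors through
    \<open>c \<cdot> F\<close>, the cokernel of \<open>k\<close>; the epi \<open>F\<close>
    cancels.\<close>
  have "is_cokernel C (G \<cdot> m) c"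
  proof (rule cokernelI[OF Gm c(1) _ epi_c])
    show "c \<cdot> G \<cdot> m = zr I D"
      using comp_assoc[OF m(1) G(1) c(1)] cG zr_comp[OF m(1)] hom_obj(2)[OF c(1)] by simp
    fix S s assume s: "s \<in> Hom P S" "s \<cdot> G \<cdot> m = zr I S"
    have "(s \<cdot> F) \<cdot> k = s \<cdot> G \<cdot> q" using comp_assoc[OF k(1) F(1) s(1)] q by simp
    also have "\<dots> = s \<cdot> (G \<cdot> m) \<cdot> e" using comp_assoc[OF e(1) m(1) G(1)] e by simp
    also have "\<dots> = zr E S"
      using comp_assoc[OF e(1) Gm s(1)] s zr_comp[OF e(1)] hom_obj(2)[OF s(1)] by simp
    finally obtain u where u: "u \<in> Hom D S" "u \<cdot> c \<cdot> F = s \<cdot> F"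
      using cokernelD(3)[OF coker k(1) cF comp_hom[OF F(1) s(1)]] by blast
    have "u \<cdot> c = s"
      using epiD[OF F(2,1) comp_hom[OF c(1) u(1)] s(1)] comp_assoc[OF F(1) c(1) u(1)] u by simp
    then show "\<exists>u\<in>Hom D S. u \<cdot> c = s" using u by blast
  qed
  moreover have "mono C (G \<cdot> m)" using mono_comp[OF m(1) G(1) kernelD(2)[OF m(2) w(1) m(1)] G(2)] .
  \<comment> \<open>Now \<open>G\<close> and \<open>G \<cdot> m\<close> are both kernels of
    \<open>c\<close>, so \<open>m\<close> has a right inverse; as \<open>w \<cdot> m\<close> is
    zero, so is \<open>w\<close>.\<close>
  ultimately have "is_kernel C c (G \<cdot> m)" using mono_kernel_of_cokernel Gm c by blast
  then obtain v where v: "v \<in> Hom B I" "(G \<cdot> m) \<cdot> v = G"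
    using kernelD(3)[OF _ c(1) Gm G(1) cG] by blast
  have B: "B \<in> c_obj C" "T \<in> c_obj C" using G t hom_obj by blast+
  have "G \<cdot> m \<cdot> v = G \<cdot> \<one> B" using comp_assoc[OF v(1) m(1) G(1)] v comp_id[OF G(1)] by simp
  then have mv: "m \<cdot> v = \<one> B" using monoD[OF G(2,1) comp_hom[OF v(1) m(1)] id_hom[OF B(1)]] by blast
  have "w = (w \<cdot> m) \<cdot> v" using comp_assoc[OF v(1) m(1) w(1)] mv comp_id[OF w(1)] by simp
  also have "\<dots> = zr B W"
    using kernelD(1)[OF m(2) w(1) m(1)] zr_comp[OF v(1)] hom_obj(2)[OF w(1)] by simp
  finally have "w = zr B W" .
  moreover obtain x where "x \<in> Hom W T" "x \<cdot> w = t" using cokernelD(3)[OF w(2) q(1) w(1) t] by blast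
  ultimately show "t = zr B T" using comp_zr B by metis
qed

text \<open>The textbook pullback is the kernel of a difference of two maps from the product to
  \<open>Z\<close>. To avoid the difference, \<open>F\<close> is \<open>f\<close> times the identity
  of \<open>B\<close>, from the product of \<open>A\<close> and \<open>B\<close> to that of
  \<open>Z\<close> and \<open>B\<close>, and \<open>G\<close> is the graph of \<open>g\<close>. The
  pullback is the preimage of the subobject \<open>G\<close> under \<open>F\<close>, namely the
  kernel of \<open>c \<cdot> F\<close>.\<close>

lemma pullback_epi_ex:
  assumes f: "f \<in> Hom A Z" "epi C f" and g: "g \<in> Hom B Z"
  obtains E p q where "pullback A B Z f g E p q" "epi C q"
proof -
  have obj: "A \<in> c_obj C" "B \<in> c_obj C" "Z \<in> c_obj C" using f g hom_obj by blast+
  obtain Q \<pi> \<pi>' where Q': "is_product C A B Q \<pi> \<pi>'" using product_ex obj by blast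
  obtain P \<rho> \<rho>' where P': "is_product C Z B P \<rho> \<rho>'" using product_ex obj by blast
  note Q = productD[OF Q'] and P = productD[OF P']
  obtain F where F: "F \<in> Hom Q P" "\<rho> \<cdot> F = f \<cdot> \<pi>" "\<rho>' \<cdot> F = \<pi>'"
    using P(3)[OF comp_hom[OF Q(1) f(1)] Q(2)] by blast
  obtain G where G: "G \<in> Hom B P" "\<rho> \<cdot> G = g" "\<rho>' \<cdot> G = \<one> B"
    using P(3)[OF g id_hom[OF obj(2)]] by blast
  obtain i' j' where Qij: "i' \<in> Hom A Q" "j' \<in> Hom B Q" "\<pi> \<cdot> i' = \<one> A" "\<pi>' \<cdot> i' = zr A B"
    "\<pi> \<cdot> j' = zr B A" "\<pi>' \<cdot> j' = \<one> B"
    using product_short_exact[OF Q'] by metis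
  obtain i j where Pij: "i \<in> Hom Z P" "j \<in> Hom B P" "\<rho> \<cdot> i = \<one> Z" "\<rho>' \<cdot> i = zr Z B"
    "\<rho> \<cdot> j = zr B Z" "\<rho>' \<cdot> j = \<one> B" and se: "short_exact C B P Z j \<rho>"
    using product_short_exact[OF P'] by metis
  have Fj: "F \<cdot> j' = j"
  proof (rule P(4)[OF comp_hom[OF Qij(2) F(1)] Pij(2)])
    show "\<rho> \<cdot> F \<cdot> j' = \<rho> \<cdot> j"
      using comp_assoc[OF Qij(2) F(1) P(1)] comp_assoc[OF Qij(2) Q(1) f(1)] F Qij Pij
        comp_zr[OF f(1) obj(2)] by simp
    show "\<rho>' \<cdot> F \<cdot> j' = \<rho>' \<cdot> j" using comp_assoc[OF Qij(2) F(1) P(2)] F Qij Pij by simp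
  qed
  have Fi: "F \<cdot> i' = i \<cdot> f"
  proof (rule P(4)[OF comp_hom[OF Qij(1) F(1)] comp_hom[OF f(1) Pij(1)]])
    show "\<rho> \<cdot> F \<cdot> i' = \<rho> \<cdot> i \<cdot> f"
      using comp_assoc[OF Qij(1) F(1) P(1)] comp_assoc[OF Qij(1) Q(1) f(1)]
        comp_assoc[OF f(1) Pij(1) P(1)] F Qij Pij comp_id[OF f(1)] id_comp[OF f(1)] by simp
    show "\<rho>' \<cdot> F \<cdot> i' = \<rho>' \<cdot> i \<cdot> f"
      using comp_assoc[OF Qij(1) F(1) P(2)] comp_assoc[OF f(1) Pij(1) P(2)] F Qij Pij
        zr_comp[OF f(1) obj(2)] by simp
  qed
  \<comment> \<open>\<open>F\<close> restricts to the identity on the factor \<open>B\<close> and to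
    the epi \<open>f\<close> on the factor \<open>A\<close>, so a map vanishing after
    \<open>F\<close> vanishes on both factors of its codomain.\<close>
  have epi_F: "epi C F"
  proof (rule epi_if_cokernel_zero[OF F(1)])
    fix T t assume t: "t \<in> Hom P T" "t \<cdot> F = zr Q T"
    have T: "T \<in> c_obj C" using t hom_obj by blast
    have "t \<cdot> j = zr B T"
      using comp_assoc[OF Qij(2) F(1) t(1)] Fj t(2) zr_comp[OF Qij(2) T] by simp
    then obtain t' where t': "t' \<in> Hom Z T" "t' \<cdot> \<rho> = t" using short_exactD(7)[OF se t(1)] by blast
    have "(t \<cdot> i) \<cdot> f = zr A T"
      using comp_assoc[OF f(1) Pij(1) t(1)] comp_assoc[OF Qij(1) F(1) t(1)] Fi t(2)
        zr_comp[OF Qij(1) T] by simp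
    then have "t \<cdot> i = zr Z T"
      using epiD[OF f(2,1) comp_hom[OF Pij(1) t(1)] zr_hom[OF obj(3) T]] zr_comp[OF f(1) T] by simp
    moreover have "t \<cdot> i = t'" using comp_assoc[OF Pij(1) P(1) t'(1)] t' Pij comp_id[OF t'(1)] by simp
    ultimately show "t = zr P T" using t' zr_comp[OF P(1) T] by simp
  qed
  have mono_G: "mono C G" using split_mono[OF G(1) P(2) G(3)] .
  obtain D c where c: "c \<in> Hom P D" "is_cokernel C G c" using cokernel_ex G by blast
  have ker_c: "is_kernel C c G" using mono_kernel_of_cokernel mono_G c G by blast
  have cF: "c \<cdot> F \<in> Hom Q D" using comp_hom[OF F(1) c(1)] .
  obtain E k where k: "k \<in> Hom E Q" "is_kernel C (c \<cdot> F) k" using kernel_ex cF by blast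
  have "c \<cdot> F \<cdot> k = zr E D" using kernelD(1)[OF k(2) cF k(1)] comp_assoc[OF k(1) F(1) c(1)] by simp
  then obtain q where q: "q \<in> Hom E B" "G \<cdot> q = F \<cdot> k"
    using kernelD(3)[OF ker_c c(1) G(1) comp_hom[OF k(1) F(1)]] by blast
  have "epi C q" using epi_of_pullback_along_mono[OF F(1) epi_F G(1) mono_G c k q] .
  have qk: "\<pi>' \<cdot> k = q"
    using comp_assoc[OF q(1) G(1) P(2)] comp_assoc[OF k(1) F(1) P(2)] q F G id_comp[OF q(1)] by simp
  have p: "\<pi> \<cdot> k \<in> Hom E A" using comp_hom[OF k(1) Q(1)] .
  have "pullback A B Z f g E (\<pi> \<cdot> k) q"
    unfolding pullback_def
  proof (intro conjI allI impI)
    show "f \<cdot> \<pi> \<cdot> k = g \<cdot> q"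
      using comp_assoc[OF k(1) Q(1) f(1)] comp_assoc[OF k(1) F(1) P(1)] comp_assoc[OF q(1) G(1) P(1)]
        F G q by simp
    fix T x y assume "x \<in> Hom T A \<and> y \<in> Hom T B \<and> f \<cdot> x = g \<cdot> y"
    then have xy: "x \<in> Hom T A" "y \<in> Hom T B" "f \<cdot> x = g \<cdot> y" by auto
    obtain z where z: "z \<in> Hom T Q" "\<pi> \<cdot> z = x" "\<pi>' \<cdot> z = y" using Q(3)[OF xy(1,2)] by blast
    have Fz: "F \<cdot> z = G \<cdot> y"
    proof (rule P(4)[OF comp_hom[OF z(1) F(1)] comp_hom[OF xy(2) G(1)]])
      show "\<rho> \<cdot> F \<cdot> z = \<rho> \<cdot> G \<cdot> y"
        using comp_assoc[OF z(1) F(1) P(1)] comp_assoc[OF xy(2) G(1) P(1)]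
          comp_assoc[OF z(1) Q(1) f(1)] F G z xy by simp
      show "\<rho>' \<cdot> F \<cdot> z = \<rho>' \<cdot> G \<cdot> y"
        using comp_assoc[OF z(1) F(1) P(2)] comp_assoc[OF xy(2) G(1) P(2)] F G z id_comp[OF xy(2)]
        by simp
    qed
    have "(c \<cdot> F) \<cdot> z = (c \<cdot> G) \<cdot> y"
      using comp_assoc[OF z(1) F(1) c(1)] comp_assoc[OF xy(2) G(1) c(1)] Fz by simp
    also have "\<dots> = zr T D"
      using kernelD(1)[OF ker_c c(1) G(1)] zr_comp[OF xy(2)] hom_obj(2)[OF c(1)] by simp
    finally obtain u where u: "u \<in> Hom T E" "k \<cdot> u = z"
      using kernelD(3)[OF k(2) cF k(1) z(1)] by blast
    have "(\<pi> \<cdot> k) \<cdot> u = x" using comp_assoc[OF u(1) k(1) Q(1)] u z by simp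
    moreover have "q \<cdot> u = y" using comp_assoc[OF u(1) k(1) Q(2)] u z qk by simp
    ultimately show "\<exists>u\<in>Hom T E. (\<pi> \<cdot> k) \<cdot> u = x \<and> q \<cdot> u = y" using u by blast
  next
    fix T u v
    assume h: "u \<in> Hom T E \<and> v \<in> Hom T E \<and> (\<pi> \<cdot> k) \<cdot> u = (\<pi> \<cdot> k) \<cdot> v \<and> q \<cdot> u = q \<cdot> v"
    then have uv: "u \<in> Hom T E" "v \<in> Hom T E" by auto
    have "k \<cdot> u = k \<cdot> v"
    proof (rule Q(4)[OF comp_hom[OF uv(1) k(1)] comp_hom[OF uv(2) k(1)]])
      show "\<pi> \<cdot> k \<cdot> u = \<pi> \<cdot> k \<cdot> v"
        using comp_assoc[OF uv(1) k(1) Q(1)] comp_assoc[OF uv(2) k(1) Q(1)] h by simp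
      show "\<pi>' \<cdot> k \<cdot> u = \<pi>' \<cdot> k \<cdot> v"
        using comp_assoc[OF uv(1) k(1) Q(2)] comp_assoc[OF uv(2) k(1) Q(2)] h qk by simp
    qed
    then show "u = v" using monoD[OF kernelD(2)[OF k(2) cF k(1)] k(1) uv] by blast
  qed (use f g p q in auto)
  with \<open>epi C q\<close> that show thesis by blast
qed

lemma pullback_short_exact:
  assumes pb: "pullback A B Z f g E p q" and se: "short_exact C X A Z a f"
  obtains k where "short_exact C X E B k q" "p \<cdot> k = a"
proof -
  note P = pullbackD[OF pb] and S = short_exactD[OF se]
  \<comment> \<open>The given pullback is arbitrary, whereas only the constructed one is known to
    have an epi projection; the comparison map \<open>u\<close> transfers this to
    \<open>q\<close>.\<close>
  obtain E' p' q' where pb': "pullback A B Z f g E' p' q'" and epi': "epi C q'"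
    using pullback_epi_ex[OF S(2,5) P(2)] by blast
  note P' = pullbackD[OF pb']
  obtain u where u: "u \<in> Hom E' E" "q \<cdot> u = q'" using P(6)[OF P'(3,4,5)] by blast
  then have epi: "epi C q" using comp_epi_right[OF u(1) P(4)] epi' by simp
  have obj: "X \<in> c_obj C" "B \<in> c_obj C" "Z \<in> c_obj C" using S(8,10) hom_obj(2)[OF P(4)] by auto
  \<comment> \<open>\<open>k\<close> is the map into the pullback with components \<open>a\<close>
    and zero.\<close>
  obtain k where k: "k \<in> Hom X E" "p \<cdot> k = a" "q \<cdot> k = zr X B"
    using P(6)[OF S(1) zr_hom[OF obj(1,2)]] S(3) comp_zr[OF P(2) obj(1)] by auto
  have "mono C k" using comp_mono_left[OF k(1) P(3)] k S(4) by simp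
  then have "short_exact C X E B k q"
  proof (rule short_exactI[OF k(1) P(4) k(3) _ epi])
    fix T t assume t: "t \<in> Hom T E" "q \<cdot> t = zr T B"
    have T: "T \<in> c_obj C" using t hom_obj by blast
    have "f \<cdot> p \<cdot> t = zr T Z"
      using comp_assoc[OF t(1) P(3) P(1)] comp_assoc[OF t(1) P(4) P(2)] P(5) t comp_zr[OF P(2) T] by simp
    then obtain x where x: "x \<in> Hom T X" "a \<cdot> x = p \<cdot> t" using S(6)[OF comp_hom[OF t(1) P(3)]] by blast
    have "k \<cdot> x = t"
    proof (rule P(7)[OF comp_hom[OF x(1) k(1)] t(1)])
      show "p \<cdot> k \<cdot> x = p \<cdot> t" using comp_assoc[OF x(1) k(1) P(3)] k x by simp
      show "q \<cdot> k \<cdot> x = q \<cdot> t" using comp_assoc[OF x(1) k(1) P(4)] k x t zr_comp[OF x(1) obj(2)] by simp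
    qed
    then show "\<exists>u\<in>Hom T X. k \<cdot> u = t" using x by blast
  qed
  with k that show thesis by blast
qed

lemma pullback_ex:
  assumes "short_exact C X A Z a f" "g \<in> Hom B Z"
  obtains E p q where "pullback A B Z f g E p q"
  using pullback_epi_ex[OF short_exactD(2,5)[OF assms(1)] assms(2)] by blast

text \<open>The pullback of the two epis onto \<open>Z\<close>, read along each of its projections
  in turn, keeps the kernel of the opposite epi.\<close>

lemma short_exact_pullback_cross:
  assumes "short_exact C X Y Z f g" "short_exact C X' W Z f' g'"
  obtains E k q k' q' where "short_exact C X E W k q" "short_exact C X' E Y k' q'"
proof -
  obtain E p q where pb: "pullback Y W Z g g' E p q"
    using pullback_ex[OF assms(1) short_exactD(2)[OF assms(2)]] by blast
  show thesis
    using pullback_short_exact[OF pb assms(1)] pullback_short_exact[OF pullback_sym[OF pb] assms(2)]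
      that by metis
qed

text \<open>The kernel \<open>K\<close> of \<open>g \<cdot> p\<close> is the preimage under
  \<open>p\<close> of the kernel \<open>Z'\<close> of \<open>g\<close>. Building it as a pullback
  along \<open>h\<close> also exhibits it as an extension of \<open>Z'\<close> by
  \<open>V\<close>.\<close>

lemma short_exact_comp_epi:
  assumes "short_exact C V Y X v p" "short_exact C Z' X Z h g"
  obtains K a b k where "short_exact C K Y Z a (g \<cdot> p)" "short_exact C V K Z' k b"
proof -
  note S = short_exactD[OF assms(1)] and S' = short_exactD[OF assms(2)]
  obtain K a b where pb: "pullback Y Z' X p h K a b" using pullback_ex[OF assms(1) S'(1)] by blast
  note P = pullbackD[OF pb]
  have "short_exact C K Y Z a (g \<cdot> p)"
  proof (rule short_exactI[OF P(3) comp_hom[OF S(2) S'(2)]])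
    show "epi C (g \<cdot> p)" using epi_comp S S' by blast
    show "mono C a"
    proof (rule monoI[OF P(3)])
      fix T t u assume tu: "t \<in> Hom T K" "u \<in> Hom T K" "a \<cdot> t = a \<cdot> u"
      have "h \<cdot> b \<cdot> t = h \<cdot> b \<cdot> u"
        using comp_assoc[OF tu(1) P(3,1)] comp_assoc[OF tu(2) P(3,1)] comp_assoc[OF tu(1) P(4,2)]
          comp_assoc[OF tu(2) P(4,2)] P(5) tu(3) by simp
      then have "b \<cdot> t = b \<cdot> u"
        using monoD[OF S'(4) P(2) comp_hom[OF tu(1) P(4)] comp_hom[OF tu(2) P(4)]] by blast
      then show "t = u" using P(7) tu by blast
    qed
    have K: "K \<in> c_obj C" using P hom_obj by blast
    show "(g \<cdot> p) \<cdot> a = zr K Z"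
      using comp_assoc[OF P(3,1) S'(2)] comp_assoc[OF P(4,2) S'(2)] P(5) S'(3) zr_comp[OF P(4) S'(10)]
      by simp
    fix T t assume t: "t \<in> Hom T Y" "(g \<cdot> p) \<cdot> t = zr T Z"
    then obtain y where "y \<in> Hom T Z'" "h \<cdot> y = p \<cdot> t"
      using S'(6)[OF comp_hom[OF t(1) S(2)]] comp_assoc[OF t(1) S(2) S'(2)] by auto
    then show "\<exists>u\<in>Hom T K. a \<cdot> u = t" using P(6)[OF t(1)] by metis
  qed
  moreover obtain k where "short_exact C V K Z' k b" using pullback_short_exact[OF pb assms(1)] by blast
  ultimately show thesis using that by blast
qed


subsection \<open>Vanishing of Ext\<close>

lemma Ext1_zero_section:
  assumes "Ext1_zero C A B" "short_exact C B E A f g"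
  obtains s where "s \<in> Hom A E" "g \<cdot> s = \<one> A"
  using retraction_imp_section assms unfolding Ext1_zero_def by metis

lemma Ext1_zeroI:
  assumes "\<And>E f g. short_exact C B E A f g \<Longrightarrow> \<exists>s\<in>Hom A E. g \<cdot> s = \<one> A"
  shows "Ext1_zero C A B"
  unfolding Ext1_zero_def using assms section_imp_retraction by metis

text \<open>Reversing arrows trades retractions for sections, and the splitting lemma makes the two
  conditions equivalent.\<close>

lemma Ext1_zero_op_cat: "Ext1_zero (op_cat C) B A \<longleftrightarrow> Ext1_zero C A B"
proof -
  have "Ext1_zero (op_cat C) B A \<longleftrightarrow>
      (\<forall>E f g. short_exact C B E A f g \<longrightarrow> (\<exists>s\<in>Hom A E. g \<cdot> s = \<one> A))"
    unfolding Ext1_zero_def by (auto simp: short_exact_op_cat)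
  also have "\<dots> \<longleftrightarrow> Ext1_zero C A B"
    using Ext1_zeroI Ext1_zero_section by metis
  finally show ?thesis .
qed

text \<open>The obstruction to lifting \<open>h\<close> is the extension pulled back along
  \<open>h\<close>; a section of it composed with the projection to \<open>Y\<close> is the
  lift.\<close>

lemma lift_if_Ext1_zero:
  assumes "short_exact C A Y Z f g" "Ext1_zero C W A" "h \<in> Hom W Z"
  obtains \<gamma> where "\<gamma> \<in> Hom W Y" "g \<cdot> \<gamma> = h"
proof -
  obtain E p q where pb: "pullback Y W Z g h E p q" using pullback_ex assms(1,3) by blast
  note P = pullbackD[OF pb]
  obtain k where "short_exact C A E W k q" using pullback_short_exact[OF pb assms(1)] by blast
  then obtain s where s: "s \<in> Hom W E" "q \<cdot> s = \<one> W" using Ext1_zero_section assms(2) by blast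
  have "g \<cdot> p \<cdot> s = h"
    using comp_assoc[OF s(1) P(3,1)] comp_assoc[OF s(1) P(4,2)] P(5) s comp_id[OF assms(3)] by simp
  then show thesis using that comp_hom[OF s(1) P(3)] by blast
qed

lemma extend_if_Ext1_zero:
  assumes "short_exact C A Y Z f g" "Ext1_zero C Z B" "h \<in> Hom A B"
  obtains \<gamma> where "\<gamma> \<in> Hom Y B" "\<gamma> \<cdot> f = h"
  using abelian_category.lift_if_Ext1_zero[OF dual, of Z Y A g f B h] assms
  by (auto simp: short_exact_op_cat Ext1_zero_op_cat)

text \<open>Without subtraction of morphisms, the usual diagram chase is replaced by the observation
  that a morphism of short exact sequences which is the identity on the left is a pullback square.\<close>

lemma Ext1_zero_if_lift:
  assumes se: "short_exact C A Y Z f g" and WY: "Ext1_zero C W Y"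
    and lift: "\<And>h. h \<in> Hom W Z \<Longrightarrow> \<exists>\<gamma>\<in>Hom W Y. g \<cdot> \<gamma> = h"
  shows "Ext1_zero C W A"
proof (rule Ext1_zeroI)
  fix E a e assume se': "short_exact C A E W a e"
  note S = short_exactD[OF se] and S' = short_exactD[OF se']
  \<comment> \<open>Vanishing of \<open>Ext^1\<close> from \<open>W\<close> to \<open>Y\<close>
    extends \<open>f\<close> over \<open>E\<close>; this presents the given extension as the one
    induced from the row \<open>se\<close> by some \<open>\<beta>\<close>.\<close>
  obtain \<alpha> where \<alpha>: "\<alpha> \<in> Hom E Y" "\<alpha> \<cdot> a = f" using extend_if_Ext1_zero[OF se' WY S(1)] by blast
  have "(g \<cdot> \<alpha>) \<cdot> a = zr A Z" using comp_assoc[OF S'(1) \<alpha>(1) S(2)] \<alpha> S(3) by simp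
  then obtain \<beta> where \<beta>: "\<beta> \<in> Hom W Z" "\<beta> \<cdot> e = g \<cdot> \<alpha>" using S'(7)[OF comp_hom[OF \<alpha>(1) S(2)]] by blast
  obtain \<gamma> where \<gamma>: "\<gamma> \<in> Hom W Y" "g \<cdot> \<gamma> = \<beta>" using lift \<beta> by blast
  obtain P p q where pb: "pullback Y W Z g \<beta> P p q" using pullback_ex se \<beta> by blast
  note P = pullbackD[OF pb]
  obtain k where k: "short_exact C A P W k q" "p \<cdot> k = f" using pullback_short_exact[OF pb se] by blast
  note K = short_exactD[OF k(1)]
  obtain u where u: "u \<in> Hom E P" "p \<cdot> u = \<alpha>" "q \<cdot> u = e"
    using P(6)[OF \<alpha>(1) S'(2)] \<beta> by auto
  \<comment> \<open>\<open>u\<close> is thus a morphism of extensions with identities at both ends,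
    hence invertible.\<close>
  have "u \<cdot> a = k"
  proof (rule P(7)[OF comp_hom[OF S'(1) u(1)] K(1)])
    show "p \<cdot> u \<cdot> a = p \<cdot> k" using comp_assoc[OF S'(1) u(1) P(3)] u \<alpha> k by simp
    show "q \<cdot> u \<cdot> a = q \<cdot> k" using comp_assoc[OF S'(1) u(1) P(4)] u S'(3) K(3) by simp
  qed
  then obtain u' where u': "u' \<in> Hom P E" "u \<cdot> u' = \<one> P"
    using short_five[OF se' k(1) u(1)] u by blast
  have W: "W \<in> c_obj C" by (fact S'(10))
  \<comment> \<open>A lift of \<open>\<beta>\<close> through \<open>g\<close>, paired with the
    identity of \<open>W\<close>, is a section of the pulled-back extension.\<close>
  obtain t where t: "t \<in> Hom W P" "q \<cdot> t = \<one> W"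
    using P(6)[OF \<gamma>(1) id_hom[OF W]] \<gamma> comp_id[OF \<beta>(1)] by auto
  have "e \<cdot> u' \<cdot> t = q \<cdot> u \<cdot> u' \<cdot> t"
    using comp_assoc[OF comp_hom[OF t(1) u'(1)] u(1) P(4)] u by simp
  also have "\<dots> = \<one> W" using comp_assoc[OF t(1) u'(1) u(1)] u' t id_comp[OF t(1)] by simp
  finally show "\<exists>s\<in>Hom W E. e \<cdot> s = \<one> W" using comp_hom[OF t(1) u'(1)] by blast
qed

lemma Ext1_zero_if_extend:
  assumes "short_exact C A Y Z f g" "Ext1_zero C Y B"
    "\<And>h. h \<in> Hom A B \<Longrightarrow> \<exists>\<gamma>\<in>Hom Y B. \<gamma> \<cdot> f = h"
  shows "Ext1_zero C Z B"
  using abelian_category.Ext1_zero_if_lift[OF dual, of Z Y A g f B] assms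
  by (simp add: short_exact_op_cat Ext1_zero_op_cat)

text \<open>Given an extension \<open>E\<close> of \<open>Y\<close> by \<open>B\<close>, lift the
  subobject \<open>X\<close> of \<open>Y\<close> to \<open>E\<close> by \<open>\<sigma>\<close> and
  divide by it. The quotient \<open>D\<close> is an extension of \<open>Z\<close> by
  \<open>B\<close>, so it has a retraction onto \<open>B\<close>, which composes with
  \<open>c\<close> to split \<open>E\<close>.\<close>

lemma Ext1_zero_extension_left:
  assumes se: "short_exact C X Y Z f g" and XB: "Ext1_zero C X B" and ZB: "Ext1_zero C Z B"
  shows "Ext1_zero C Y B"
  unfolding Ext1_zero_def
proof (intro allI impI)
  fix E b e assume se': "short_exact C B E Y b e"
  note S = short_exactD[OF se] and S' = short_exactD[OF se']
  obtain \<sigma> where \<sigma>: "\<sigma> \<in> Hom X E" "e \<cdot> \<sigma> = f" using lift_if_Ext1_zero[OF se' XB S(1)] by blast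
  obtain D c where c: "c \<in> Hom E D" "is_cokernel C \<sigma> c" using cokernel_ex \<sigma> by blast
  have mono_\<sigma>: "mono C \<sigma>" using comp_mono_left[OF \<sigma>(1) S'(2)] \<sigma> S(4) by simp
  have se_c: "short_exact C X E D \<sigma> c"
    using mono_kernel_of_cokernel[OF mono_\<sigma> c(2) \<sigma>(1) c(1)] c \<sigma> by (simp add: short_exact_iff)
  note K = short_exactD[OF se_c]
  have ge: "g \<cdot> e \<in> Hom E Z" using comp_hom[OF S'(2) S(2)] .
  have "(g \<cdot> e) \<cdot> \<sigma> = zr X Z" using comp_assoc[OF \<sigma>(1) S'(2) S(2)] \<sigma> S(3) by simp
  then obtain h where h: "h \<in> Hom D Z" "h \<cdot> c = g \<cdot> e" using K(7)[OF ge] by blast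
  have cb: "c \<cdot> b \<in> Hom B D" using comp_hom[OF S'(1) c(1)] .
  have "short_exact C B D Z (c \<cdot> b) h"
  proof (rule short_exactI'[OF cb h(1)])
    show "h \<cdot> c \<cdot> b = zr B Z"
      using comp_assoc[OF S'(1) c(1) h(1)] comp_assoc[OF S'(1,2) S(2)] h S'(3) comp_zr[OF S(2) S'(8)]
      by simp
    have "epi C (g \<cdot> e)" using epi_comp S'(2,5) S(2,5) by blast
    then show "epi C h" using comp_epi_right[OF c(1) h(1)] h by simp
    show "mono C (c \<cdot> b)"
    proof (rule mono_if_kernel_zero[OF cb])
      fix T x assume x: "x \<in> Hom T B" "(c \<cdot> b) \<cdot> x = zr T D"
      have T: "T \<in> c_obj C" using x hom_obj by blast
      have "c \<cdot> b \<cdot> x = zr T D" using comp_assoc[OF x(1) S'(1) c(1)] x by simp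
      then obtain y where y: "y \<in> Hom T X" "\<sigma> \<cdot> y = b \<cdot> x"
        using K(6)[OF comp_hom[OF x(1) S'(1)]] by blast
      have "f \<cdot> y = e \<cdot> b \<cdot> x" using comp_assoc[OF y(1) \<sigma>(1) S'(2)] \<sigma> y by simp
      also have "\<dots> = zr T Y" using comp_assoc[OF x(1) S'(1,2)] S'(3) zr_comp[OF x(1) S(9)] by simp
      also have "\<dots> = f \<cdot> zr T X" using comp_zr[OF S(1) T] by simp
      finally have "y = zr T X" using monoD[OF S(4,1) y(1) zr_hom[OF T S(8)]] by blast
      then have "b \<cdot> x = b \<cdot> zr T B" using y comp_zr[OF \<sigma>(1) T] comp_zr[OF S'(1) T] by simp
      then show "x = zr T B" using monoD[OF S'(4,1) x(1) zr_hom[OF T S'(8)]] by blast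
    qed
    fix T t assume t: "t \<in> Hom D T" "t \<cdot> c \<cdot> b = zr B T"
    have tc: "t \<cdot> c \<in> Hom E T" using comp_hom[OF c(1) t(1)] .
    have "(t \<cdot> c) \<cdot> b = zr B T" using comp_assoc[OF S'(1) c(1) t(1)] t by simp
    then obtain t' where t': "t' \<in> Hom Y T" "t' \<cdot> e = t \<cdot> c" using S'(7)[OF tc] by blast
    have "t' \<cdot> f = (t \<cdot> c) \<cdot> \<sigma>" using comp_assoc[OF \<sigma>(1) S'(2) t'(1)] \<sigma> t' by simp
    also have "\<dots> = zr X T"
      using comp_assoc[OF \<sigma>(1) c(1) t(1)] K(3) comp_zr[OF t(1) K(8)] by simp
    finally obtain w where w: "w \<in> Hom Z T" "w \<cdot> g = t'" using S(7)[OF t'(1)] by blast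
    have "(w \<cdot> h) \<cdot> c = t \<cdot> c"
      using comp_assoc[OF c(1) h(1) w(1)] comp_assoc[OF S'(2) S(2) w(1)] h w t' by simp
    then have "w \<cdot> h = t" using epiD[OF K(5,2) comp_hom[OF h(1) w(1)] t(1)] by blast
    then show "\<exists>u\<in>Hom Z T. u \<cdot> h = t" using w by blast
  qed
  then obtain r where r: "r \<in> Hom D B" "r \<cdot> c \<cdot> b = \<one> B" using ZB unfolding Ext1_zero_def by blast
  then have "(r \<cdot> c) \<cdot> b = \<one> B" using comp_assoc[OF S'(1) c(1) r(1)] by simp
  then show "\<exists>r\<in>Hom E B. r \<cdot> b = \<one> B" using comp_hom[OF c(1) r(1)] by blast
qed

lemma Ext1_zero_extension_right:
  "short_exact C X Y Z f g \<Longrightarrow> Ext1_zero C W X \<Longrightarrow> Ext1_zero C W Z \<Longrightarrow> Ext1_zero C W Y"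
  using abelian_category.Ext1_zero_extension_left[OF dual, of Z Y X g f W]
  by (simp add: short_exact_op_cat Ext1_zero_op_cat)

text \<open>Pull the extension back along \<open>p\<close>, where it splits. The map
  \<open>u\<close> with components the identity of \<open>E\<close> and \<open>i \<cdot> e\<close>
  embeds \<open>E\<close> compatibly with \<open>B\<close>, so the retraction restricts.\<close>

lemma Ext1_zero_retract_left:
  assumes ip: "i \<in> Hom N Y" "p \<in> Hom Y N" "p \<cdot> i = \<one> N" and YB: "Ext1_zero C Y B"
  shows "Ext1_zero C N B"
  unfolding Ext1_zero_def
proof (intro allI impI)
  fix E b e assume se: "short_exact C B E N b e"
  note S = short_exactD[OF se]
  obtain E' p' e' where pb: "pullback E Y N e p E' p' e'" using pullback_ex se ip by blast
  note P = pullbackD[OF pb]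
  obtain b' where b': "short_exact C B E' Y b' e'" "p' \<cdot> b' = b" using pullback_short_exact[OF pb se] by blast
  note S' = short_exactD[OF b'(1)]
  have "e \<cdot> \<one> E = p \<cdot> i \<cdot> e"
    using comp_assoc[OF S(2) ip(1,2)] ip id_comp[OF S(2)] comp_id[OF S(2)] by simp
  then obtain u where u: "u \<in> Hom E E'" "p' \<cdot> u = \<one> E" "e' \<cdot> u = i \<cdot> e"
    using P(6)[OF id_hom[OF S(9)] comp_hom[OF S(2) ip(1)]] by blast
  have ub: "u \<cdot> b = b'"
  proof (rule P(7)[OF comp_hom[OF S(1) u(1)] S'(1)])
    show "p' \<cdot> u \<cdot> b = p' \<cdot> b'" using comp_assoc[OF S(1) u(1) P(3)] u b' id_comp[OF S(1)] by simp
    show "e' \<cdot> u \<cdot> b = e' \<cdot> b'"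
      using comp_assoc[OF S(1) u(1) P(4)] comp_assoc[OF S(1,2) ip(1)] u S(3) S'(3)
        comp_zr[OF ip(1) S(8)] by simp
  qed
  obtain r where r: "r \<in> Hom E' B" "r \<cdot> b' = \<one> B" using YB b'(1) unfolding Ext1_zero_def by blast
  then have "(r \<cdot> u) \<cdot> b = \<one> B" using comp_assoc[OF S(1) u(1) r(1)] ub by simp
  then show "\<exists>r\<in>Hom E B. r \<cdot> b = \<one> B" using comp_hom[OF u(1) r(1)] by blast
qed

lemma Ext1_zero_retract_right:
  "i \<in> Hom N Y \<Longrightarrow> p \<in> Hom Y N \<Longrightarrow> p \<cdot> i = \<one> N \<Longrightarrow> Ext1_zero C W Y \<Longrightarrow> Ext1_zero C W N"
  using abelian_category.Ext1_zero_retract_left[OF dual, of p N Y i W]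
  by (simp add: Ext1_zero_op_cat)

end

text \<open>A split short exact sequence in place of \<open>is_coproduct\<close>: the opposite
  category then merely swaps \<open>A\<close> and \<open>B\<close>, whereas a coproduct would become
  a product.\<close>

definition direct_sum :: "('o,'m) category \<Rightarrow> 'o \<Rightarrow> 'o \<Rightarrow> 'o \<Rightarrow> bool" where
  "direct_sum C A E B \<longleftrightarrow>
     (\<exists>f g r. short_exact C A E B f g \<and> r \<in> hom C E A \<and> c_comp C r f = c_id C A)"

context abelian_category
begin

subsection \<open>Direct sums\<close>

lemma direct_sum_iff_section:
  "direct_sum C A E B \<longleftrightarrow> (\<exists>f g s. short_exact C A E B f g \<and> s \<in> Hom B E \<and> g \<cdot> s = \<one> B)"
  unfolding direct_sum_def using retraction_imp_section section_imp_retraction by metis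

lemma direct_sum_op_cat: "direct_sum (op_cat C) B E A \<longleftrightarrow> direct_sum C A E B"
  unfolding direct_sum_iff_section by (auto simp: direct_sum_def short_exact_op_cat)

lemma direct_sum_coproduct: "is_coproduct C A B E i j \<Longrightarrow> direct_sum C A E B"
  unfolding direct_sum_def using coproduct_short_exact by metis

lemma direct_sumE:
  assumes "direct_sum C A E B"
  obtains i j p q where "is_coproduct C A B E i j" "short_exact C A E B i q"
    "p \<in> Hom E A" "p \<cdot> i = \<one> A" "q \<cdot> j = \<one> B"
  using assms coproduct_if_section section_imp_retraction
  unfolding direct_sum_iff_section by metis

lemma direct_sum_sym: "direct_sum C A E B \<Longrightarrow> direct_sum C B E A"
proof -
  assume "direct_sum C A E B"
  then obtain i j where "is_coproduct C A B E i j" by (rule direct_sumE)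
  then have "is_coproduct C B A E j i" unfolding is_coproduct_def by (simp add: conj_commute)
  then show ?thesis by (rule direct_sum_coproduct)
qed

lemma direct_sum_ex:
  assumes "A \<in> c_obj C" "B \<in> c_obj C"
  obtains E where "direct_sum C A E B"
  by (rule coproduct_ex[OF assms]) (use that direct_sum_coproduct in blast)

text \<open>Encodes an isomorphism as a direct sum with a zero object. As zero objects lie in
  \<omega>, results about adding or removing summands from \<omega> then also yield invariance under
  isomorphism.\<close>

lemma direct_sum_zero:
  assumes "h \<in> Hom X Y" "h' \<in> Hom Y X" "h' \<cdot> h = \<one> X" "h \<cdot> h' = \<one> Y" "zero_obj C Z"
  shows "direct_sum C X Y Z"
proof -
  have obj: "X \<in> c_obj C" "Y \<in> c_obj C" using assms hom_obj by blast+
  have Z: "Z \<in> c_obj C" using zero_objD(1)[OF assms(5) obj(1)] .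
  have z: "zr Y Z \<in> Hom Y Z" using zr_hom obj Z by blast
  have "zr Y Z \<cdot> zr Z Y = \<one> Z"
    using zero_objD(4)[OF assms(5) Z] comp_hom[OF zr_hom zr_hom] id_hom obj Z by blast
  then have "epi C (zr Y Z)" using split_epi[OF z zr_hom[OF Z obj(2)]] by blast
  then have "short_exact C X Y Z h (zr Y Z)"
  proof (rule short_exactI[OF assms(1) z zr_comp[OF assms(1) Z] split_mono[OF assms(1-3)]])
    fix T t assume t: "t \<in> Hom T Y"
    then have "h \<cdot> h' \<cdot> t = t" using comp_assoc[OF t assms(2,1)] assms(4) id_comp by simp
    then show "\<exists>u\<in>Hom T X. h \<cdot> u = t" using comp_hom[OF t assms(2)] by blast
  qed
  then show ?thesis using assms unfolding direct_sum_def by blast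
qed

text \<open>The conclusion is an isomorphism between \<open>E\<close> and \<open>E'\<close>, in the
  encoding of \<open>direct_sum_zero\<close>.\<close>

lemma direct_sum_unique:
  assumes "direct_sum C A E B" "direct_sum C A E' B" "zero_obj C Z"
  shows "direct_sum C E E' Z"
proof -
  obtain i j p q where E: "is_coproduct C A B E i j" "short_exact C A E B i q" "q \<cdot> j = \<one> B"
    using direct_sumE[OF assms(1)] by metis
  obtain i' j' p' q' where E': "is_coproduct C A B E' i' j'" "short_exact C A E' B i' q'" "q' \<cdot> j' = \<one> B"
    using direct_sumE[OF assms(2)] by metis
  note S = coproductD[OF E(1)] and S' = coproductD[OF E'(1)]
    and T = short_exactD[OF E(2)] and T' = short_exactD[OF E'(2)]
  obtain h where h: "h \<in> Hom E E'" "h \<cdot> i = i'" "h \<cdot> j = j'" using S(3)[OF S'(1,2)] by blast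
  have "q' \<cdot> h = q"
  proof (rule S(4)[OF comp_hom[OF h(1) T'(2)] T(2)])
    show "(q' \<cdot> h) \<cdot> i = q \<cdot> i" using comp_assoc[OF S(1) h(1) T'(2)] h T(3) T'(3) by simp
    show "(q' \<cdot> h) \<cdot> j = q \<cdot> j" using comp_assoc[OF S(2) h(1) T'(2)] h E E' by simp
  qed
  then obtain h' where "h' \<in> Hom E' E" "h' \<cdot> h = \<one> E" "h \<cdot> h' = \<one> E'"
    using short_five[OF E(2) E'(2) h(1,2)] by blast
  then show ?thesis using direct_sum_zero h assms(3) by blast
qed

end


section \<open>Loops as cycles of a relation\<close>

definition perp :: "('o,'m) category \<Rightarrow> 'o set \<Rightarrow> 'o set \<Rightarrow> 'o set" where
  "perp C \<U> \<V> = right_perp1 C \<U> \<inter> left_perp1 C \<V>"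

definition step :: "('o,'m) category \<Rightarrow> 'o set \<Rightarrow> 'o set \<Rightarrow> 'o set \<Rightarrow> 'o rel" where
  "step C \<W> \<U> \<V> = {(x, y). x \<in> perp C \<U> \<V> \<and> y \<in> perp C \<U> \<V> \<and>
     (\<exists>E\<in>\<W>. \<exists>f g. short_exact C x E y f g)}"

definition loops :: "'o rel \<Rightarrow> nat \<Rightarrow> 'o set" where
  "loops R m = {M. (M, M) \<in> R ^^ m}"

text \<open>Only the first and the last step see the ends of a walk. They are changed one after the
  other, because for \<open>m = 1\<close> they are the same step.\<close>

lemma relpow_change_ends:
  fixes R :: "'a rel"
  assumes "(x, y) \<in> R ^^ m" "m \<ge> 1" "\<And>z. (x, z) \<in> R \<Longrightarrow> (x', z) \<in> R"
    "\<And>z. (z, y) \<in> R \<Longrightarrow> (z, y') \<in> R"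
  shows "(x', y') \<in> R ^^ m"
proof -
  obtain n where m: "m = Suc n" using assms(2) by (cases m) auto
  obtain z where "(x, z) \<in> R" "(z, y) \<in> R ^^ n" using assms(1) m relpow_Suc_D2 by metis
  then have "(x', y) \<in> R ^^ Suc n" using assms(3) relpow_Suc_I2 by metis
  then obtain w where "(x', w) \<in> R ^^ n" "(w, y) \<in> R" by auto
  then show ?thesis using assms(4) m by auto
qed

text \<open>Rotating the closed walk moves its last step to the front, so the last object before
  \<open>M\<close> has a closed walk of the same length.\<close>

lemma loops_predecessor:
  assumes "M \<in> loops R m" "m \<ge> 1"
  obtains N where "N \<in> loops R m" "(N, M) \<in> R"
proof -
  obtain n where m: "m = Suc n" using assms(2) by (cases m) auto
  obtain N where N: "(M, N) \<in> R ^^ n" "(N, M) \<in> R" using assms(1) m by (auto simp: loops_def)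
  then have "(N, N) \<in> R ^^ Suc n" using relpow_Suc_I2 by metis
  then show thesis using N that m by (simp add: loops_def)
qed

lemma loops_converse: "loops (R\<inverse>) m = loops R m"
proof -
  have "(R\<inverse>) ^^ m = (R ^^ m)\<inverse>"
  proof (induction m)
    case (Suc m)
    then show ?case by (metis converse_relcomp relpow.simps(2) relpow_commute)
  qed auto
  then show ?thesis by (simp add: loops_def)
qed

text \<open>The two classes \<open>\<U>\<close> and \<open>\<V>\<close> generalise the theorem's \<open>\<W>\<close> and \<open>\<B>\<close> so that passing to the
  opposite category merely exchanges them.\<close>

locale loop_setting = abelian_category C for C :: "('o,'m) category" +
  fixes \<W> \<U> \<V> :: "'o set"
  assumes zero_in: "zero_obj C Z \<Longrightarrow> Z \<in> \<W>"
    and direct_sum_in_iff: "direct_sum C A E B \<Longrightarrow> E \<in> \<W> \<longleftrightarrow> A \<in> \<W> \<and> B \<in> \<W>"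
    and W_obj: "\<W> \<subseteq> c_obj C" and W_sub_U: "\<W> \<subseteq> \<U>" and W_sub_V: "\<W> \<subseteq> \<V>"
    and Ext_UW: "A \<in> \<U> \<Longrightarrow> B \<in> \<W> \<Longrightarrow> Ext1_zero C A B"
    and Ext_WV: "A \<in> \<W> \<Longrightarrow> B \<in> \<V> \<Longrightarrow> Ext1_zero C A B"
begin

abbreviation "T \<equiv> perp C \<U> \<V>"
abbreviation "S \<equiv> step C \<W> \<U> \<V>"

lemma dual_setting: "loop_setting (op_cat C) \<W> \<V> \<U>"
proof -
  interpret op: abelian_category "op_cat C" by (rule dual)
  show ?thesis
  proof
    fix A E B assume "direct_sum (op_cat C) A E B"
    then show "E \<in> \<W> \<longleftrightarrow> A \<in> \<W> \<and> B \<in> \<W>" using direct_sum_in_iff direct_sum_op_cat by blast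
  qed (use zero_in W_obj W_sub_U W_sub_V Ext_UW Ext_WV Ext1_zero_op_cat in auto)
qed

lemma right_perp1_op_cat: "right_perp1 (op_cat C) \<X> = left_perp1 C \<X>"
  by (simp add: right_perp1_def left_perp1_def Ext1_zero_op_cat)

lemma left_perp1_op_cat: "left_perp1 (op_cat C) \<X> = right_perp1 C \<X>"
  by (simp add: right_perp1_def left_perp1_def Ext1_zero_op_cat)

text \<open>Dualising reverses sequences and swaps the two orthogonality conditions. With
  \<open>loops_converse\<close>, the class of loops is self-dual.\<close>

lemma step_op_cat: "step (op_cat C) \<W> \<V> \<U> = S\<inverse>"
  by (auto simp: step_def perp_def right_perp1_op_cat left_perp1_op_cat short_exact_op_cat)

lemma T_iff: "N \<in> T \<longleftrightarrow> N \<in> c_obj C \<and> (\<forall>u\<in>\<U>. Ext1_zero C u N) \<and> (\<forall>v\<in>\<V>. Ext1_zero C N v)"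
  by (auto simp: perp_def right_perp1_def left_perp1_def)

lemma W_sub_T: "\<W> \<subseteq> T"
  using W_obj Ext_UW Ext_WV by (auto simp: T_iff)

lemma T_extension:
  assumes "short_exact C X Y Z f g" "X \<in> T" "Z \<in> T"
  shows "Y \<in> T"
  using Ext1_zero_extension_left[OF assms(1)] Ext1_zero_extension_right[OF assms(1)]
    short_exactD(9)[OF assms(1)] assms(2,3) unfolding T_iff by blast

lemma T_summand:
  assumes "direct_sum C N M W" "M \<in> T"
  shows "N \<in> T"
proof -
  obtain i j p q where ds: "short_exact C N M W i q" "p \<in> Hom M N" "p \<cdot> i = \<one> N"
    using direct_sumE[OF assms(1)] by metis
  note D = short_exactD[OF ds(1)]
  show ?thesis
    using assms(2) Ext1_zero_retract_left[OF D(1) ds(2,3)] Ext1_zero_retract_right[OF D(1) ds(2,3)] D(8)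
    unfolding T_iff by blast
qed

text \<open>Let \<open>K\<close> be the preimage of \<open>N\<close> in the middle term
  \<open>E\<close>. The inclusion of \<open>W\<close> in \<open>M\<close> lifts to \<open>E\<close>
  because \<open>Ext^1\<close> from \<open>W\<close> to \<open>x\<close> vanishes; so
  \<open>E\<close> is the direct sum of \<open>K\<close> and \<open>W\<close>, and its summand
  \<open>K\<close> lies in \<open>\<W>\<close>.\<close>

lemma step_drop_right:
  assumes "(x, M) \<in> S" "direct_sum C N M W" "W \<in> \<W>"
  shows "(x, N) \<in> S"
proof -
  obtain E f g where E: "E \<in> \<W>" "short_exact C x E M f g" and x: "x \<in> T" and M: "M \<in> T"
    using assms(1) by (auto simp: step_def)
  obtain i j p q where ds: "is_coproduct C N W M i j" "short_exact C N M W i q" "q \<cdot> j = \<one> W"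
    using direct_sumE[OF assms(2)] by metis
  note D = short_exactD[OF ds(2)] and F = short_exactD[OF E(2)]
  obtain K a b k where K: "short_exact C K E W a (q \<cdot> g)" "short_exact C x K N k b"
    using short_exact_comp_epi[OF E(2) ds(2)] by metis
  have j: "j \<in> Hom W M" using coproductD(2)[OF ds(1)] .
  have "Ext1_zero C W x" using x assms(3) W_sub_U by (auto simp: T_iff)
  then obtain \<gamma> where \<gamma>: "\<gamma> \<in> Hom W E" "g \<cdot> \<gamma> = j" using lift_if_Ext1_zero[OF E(2) _ j] by blast
  then have "(q \<cdot> g) \<cdot> \<gamma> = \<one> W" using comp_assoc[OF \<gamma>(1) F(2) D(2)] ds by simp
  then have "direct_sum C K E W" using K(1) \<gamma> unfolding direct_sum_iff_section by blast
  then have "K \<in> \<W>" using direct_sum_in_iff E by blast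
  then show ?thesis using K(2) x T_summand[OF assms(2) M] by (auto simp: step_def)
qed

lemma step_drop_left:
  assumes "(M, y) \<in> S" "direct_sum C N M W" "W \<in> \<W>"
  shows "(N, y) \<in> S"
  using loop_setting.step_drop_right[OF dual_setting, of y M N W] assms direct_sum_sym
  by (simp add: step_op_cat direct_sum_op_cat)

text \<open>Enlarge \<open>E\<close> to its direct sum \<open>E'\<close> with \<open>W\<close>. The
  preimage \<open>K\<close> of \<open>x\<close> in \<open>E'\<close> is an extension of
  \<open>x\<close> by \<open>W\<close>, which splits since \<open>x\<close> is left orthogonal to
  \<open>\<V>\<close>.\<close>

lemma step_add_left:
  assumes "(x, y) \<in> S" "direct_sum C x M W" "W \<in> \<W>"
  shows "(M, y) \<in> S"
proof -
  obtain E f g where E: "E \<in> \<W>" "short_exact C x E y f g" and x: "x \<in> T" and y: "y \<in> T"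
    using assms(1) by (auto simp: step_def)
  obtain E' where E': "direct_sum C E E' W" using direct_sum_ex E(1) assms(3) W_obj by blast
  obtain v p where vp: "short_exact C W E' E v p"
    using direct_sum_sym[OF E'] by (auto simp: direct_sum_def)
  obtain K a b k where K: "short_exact C K E' y a (g \<cdot> p)" "short_exact C W K x k b"
    using short_exact_comp_epi[OF vp E(2)] by metis
  have "Ext1_zero C x W" using x assms(3) W_sub_V by (auto simp: T_iff)
  then have WKx: "direct_sum C W K x" using K(2) unfolding direct_sum_def Ext1_zero_def by blast
  have "K \<in> T" using T_extension[OF K(2)] assms(3) W_sub_T x by blast
  moreover have "E' \<in> \<W>" using direct_sum_in_iff[OF E'] E assms(3) by blast
  ultimately have "(K, y) \<in> S" using K(1) y by (auto simp: step_def)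
  \<comment> \<open>\<open>M\<close> and \<open>K\<close> are both direct sums of \<open>x\<close>
    and \<open>W\<close>, so \<open>M\<close> is \<open>K\<close> up to a zero summand, which
    \<open>step_drop_left\<close> removes.\<close>
  moreover obtain Z where Z: "zero_obj C Z" by (rule zero_obj_ex)
  ultimately show ?thesis
    using step_drop_left direct_sum_unique[OF assms(2) direct_sum_sym[OF WKx] Z] zero_in[OF Z] by blast
qed

lemma step_add_right:
  assumes "(x, y) \<in> S" "direct_sum C y M W" "W \<in> \<W>"
  shows "(x, M) \<in> S"
  using loop_setting.step_add_left[OF dual_setting, of y x M W] assms direct_sum_sym
  by (simp add: step_op_cat direct_sum_op_cat)

lemma loops_direct_sum:
  assumes "m \<ge> 1" "direct_sum C N M W" "W \<in> \<W>"
  shows "M \<in> loops S m \<longleftrightarrow> N \<in> loops S m"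
proof
  assume "M \<in> loops S m"
  then have "(M, M) \<in> S ^^ m" by (simp add: loops_def)
  then have "(N, N) \<in> S ^^ m"
    by (rule relpow_change_ends) (use assms step_drop_left step_drop_right in blast)+
  then show "N \<in> loops S m" by (simp add: loops_def)
next
  assume "N \<in> loops S m"
  then have "(N, N) \<in> S ^^ m" by (simp add: loops_def)
  then have "(M, M) \<in> S ^^ m"
    by (rule relpow_change_ends) (use assms step_add_left step_add_right in blast)+
  then show "M \<in> loops S m" by (simp add: loops_def)
qed

lemma loops_sub_T:
  assumes "m \<ge> 1"
  shows "loops S m \<subseteq> T"
  using loops_predecessor[OF _ assms] by (force simp: step_def)

lemma loops_successor:
  assumes "M \<in> loops S m" "m \<ge> 1"
  obtains N where "N \<in> loops S m" "(M, N) \<in> S"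
  using loops_predecessor[of M "S\<inverse>" m] assms by (auto simp: loops_converse)

section \<open>Extension closure against kernels and cokernels\<close>

definition ext_closed :: "'o set \<Rightarrow> bool" where
  "ext_closed P \<longleftrightarrow> (\<forall>X Y Z f g. short_exact C X Y Z f g \<and> X \<in> P \<and> Z \<in> P \<longrightarrow> Y \<in> P)"

lemma ext_closed_iff_kernels:
  assumes m: "m \<ge> 1"
  shows "ext_closed (loops S m) \<longleftrightarrow>
    (\<forall>X Y Z f g. short_exact C X Y Z f g \<and> Y \<in> loops S m \<and> Z \<in> loops S m \<longrightarrow>
       (X \<in> loops S m \<longleftrightarrow> X \<in> right_perp1 C \<U>))" (is "_ \<longleftrightarrow> ?b")
proof
  assume a: "ext_closed (loops S m)"
  show ?b
  proof (intro allI impI)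
    fix X Y Z f g
    assume "short_exact C X Y Z f g \<and> Y \<in> loops S m \<and> Z \<in> loops S m"
    then have se: "short_exact C X Y Z f g" and Y: "Y \<in> loops S m" and Z: "Z \<in> loops S m" by auto
    show "X \<in> loops S m \<longleftrightarrow> X \<in> right_perp1 C \<U>"
    proof
      show "X \<in> loops S m \<Longrightarrow> X \<in> right_perp1 C \<U>"
        using loops_sub_T[OF m] by (auto simp: perp_def)
      assume X: "X \<in> right_perp1 C \<U>"
      \<comment> \<open>A predecessor of \<open>Z\<close> is needed so that its step ends in
        \<open>Z\<close> and can be pulled back against the given sequence.\<close>
      obtain N where N: "N \<in> loops S m" "(N, Z) \<in> S" using loops_predecessor[OF Z m] by blast
      then obtain W f' g' where W: "W \<in> \<W>" "short_exact C N W Z f' g'" by (auto simp: step_def)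
      obtain E k q k' q' where E: "short_exact C X E W k q" "short_exact C N E Y k' q'"
        using short_exact_pullback_cross[OF se W(2)] by metis
      \<comment> \<open>Orthogonality of \<open>X\<close> splits the extension of \<open>W\<close>
        by \<open>X\<close>, while extension closure applies to the other sequence through
        \<open>E\<close>.\<close>
      have "Ext1_zero C W X" using X W W_sub_U by (auto simp: right_perp1_def)
      then have "direct_sum C X E W" using E(1) unfolding Ext1_zero_def direct_sum_def by blast
      moreover have "E \<in> loops S m" using a E(2) N(1) Y unfolding ext_closed_def by blast
      ultimately show "X \<in> loops S m" using loops_direct_sum[OF m] W(1) by blast
    qed
  qed
next
  assume b: ?b
  show "ext_closed (loops S m)"
    unfolding ext_closed_def
  proof (intro allI impI)
    fix X Y Z f g
    assume "short_exact C X Y Z f g \<and> X \<in> loops S m \<and> Z \<in> loops S m"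
    then have se: "short_exact C X Y Z f g" and X: "X \<in> loops S m" and Z: "Z \<in> loops S m" by auto
    obtain N where N: "N \<in> loops S m" "(X, N) \<in> S" using loops_successor[OF X m] by blast
    then obtain W f' g' where W: "W \<in> \<W>" "short_exact C X W N f' g'" by (auto simp: step_def)
    \<comment> \<open>A pushout of \<open>Y\<close> and \<open>W\<close> under \<open>X\<close>,
      obtained as a pullback in the opposite category.\<close>
    obtain E k q k' q' where E: "short_exact C W E Z q k" "short_exact C Y E N q' k'"
      using abelian_category.short_exact_pullback_cross[OF dual, of Z Y X g f N W g' f'] se W(2)
      unfolding short_exact_op_cat by metis
    have "Z \<in> T" using Z loops_sub_T[OF m] by blast
    then have "Ext1_zero C Z W" using W W_sub_V by (auto simp: T_iff)
    then have "direct_sum C W E Z" using E(1) unfolding Ext1_zero_def direct_sum_def by blast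
    then have "E \<in> loops S m" using loops_direct_sum[OF m] direct_sum_sym Z W(1) by blast
    \<comment> \<open>\<open>Y\<close> is the kernel of a map between members of the class, so the
      assumed criterion leaves only its orthogonality to check; \<open>T\<close> is closed under
      extensions.\<close>
    moreover have "Y \<in> right_perp1 C \<U>"
      using T_extension[OF se] X Z loops_sub_T[OF m] by (auto simp: perp_def)
    ultimately show "Y \<in> loops S m" using b E(2) N(1) by blast
  qed
qed

text \<open>The kernel criterion in the opposite category, where extension closure and the class of
  loops are unchanged.\<close>

lemma ext_closed_iff_cokernels:
  assumes m: "m \<ge> 1"
  shows "ext_closed (loops S m) \<longleftrightarrow>
    (\<forall>X Y Z f g. short_exact C X Y Z f g \<and> X \<in> loops S m \<and> Y \<in> loops S m \<longrightarrow>
       (Z \<in> loops S m \<longleftrightarrow> Z \<in> left_perp1 C \<V>))"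
proof -
  interpret op: loop_setting "op_cat C" \<W> \<V> \<U> by (rule dual_setting)
  have "op.ext_closed (loops S m) \<longleftrightarrow> ext_closed (loops S m)"
    unfolding op.ext_closed_def ext_closed_def short_exact_op_cat by blast
  then show ?thesis
    using op.ext_closed_iff_kernels[OF m]
    unfolding step_op_cat loops_converse short_exact_op_cat right_perp1_op_cat by blast
qed


subsection \<open>Periodic Gorenstein projective objects\<close>

text \<open>Here \<open>c n\<close> is the n-th cycle object, and exactness makes the corestriction
  of each differential to the cycles below an epi.\<close>

lemma exact_complex_short_exact:
  assumes "exact_complex C X d"
  obtains c k u where "\<And>n. is_kernel C (d n) (k n)" "\<And>n. d n = k (n - 1) \<cdot> u n"
    "\<And>n. short_exact C (c n) (X n) (c (n - 1)) (k n) (u n)"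
proof -
  have d: "d n \<in> Hom (X n) (X (n - 1))" for n
    using assms by (simp add: exact_complex_def chain_complex_def)
  have "\<exists>k u. is_kernel C (d n) k \<and> u \<in> Hom (X (n + 1)) (c_dom C k) \<and> k \<cdot> u = d (n + 1) \<and> epi C u" for n
    using assms unfolding exact_complex_def exact_at_def hom_arr(2)[OF d, symmetric] by blast
  then obtain k u' where ker: "\<And>n. is_kernel C (d n) (k n)"
    and u': "\<And>n. u' n \<in> Hom (X (n + 1)) (c_dom C (k n))" "\<And>n. k n \<cdot> u' n = d (n + 1)"
      "\<And>n. epi C (u' n)"
    by metis
  define c where "c n = c_dom C (k n)" for n
  \<comment> \<open>Exactness at degree \<open>n\<close> concerns \<open>d (n + 1)\<close>; the
    shift makes \<open>u n\<close> start at \<open>X n\<close>.\<close>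
  define u where "u n = u' (n - 1)" for n
  have k: "k n \<in> Hom (c n) (X n)" for n
    using ker[of n] hom_arr(2)[OF d[of n]] by (simp add: is_kernel_def hom_def c_def)
  have u: "u n \<in> Hom (X n) (c (n - 1))" "d n = k (n - 1) \<cdot> u n" "epi C (u n)" for n
    using u'[of "n - 1"] by (simp_all add: u_def c_def)
  have "short_exact C (c n) (X n) (c (n - 1)) (k n) (u n)" for n
  proof -
    note K = kernelD[OF ker d k] and k' = k[of "n - 1"]
    have mono_k: "mono C (k (n - 1))" by (rule K(2))
    \<comment> \<open>\<open>d n\<close> is \<open>u n\<close> followed by a mono, so both kill the
      same morphisms and have the same kernel.\<close>
    have zero_iff: "u n \<cdot> t = zr T (c (n - 1)) \<longleftrightarrow> d n \<cdot> t = zr T (X (n - 1))" if t: "t \<in> Hom T (X n)" for T t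
    proof -
      have T: "T \<in> c_obj C" using t hom_obj by blast
      have "d n \<cdot> t = k (n - 1) \<cdot> u n \<cdot> t" using comp_assoc[OF t u(1) k'] u(2)[of n] by simp
      moreover have "zr T (X (n - 1)) = k (n - 1) \<cdot> zr T (c (n - 1))" using comp_zr[OF k' T] by simp
      ultimately show ?thesis
        using monoD[OF mono_k k' comp_hom[OF t u(1)] zr_hom[OF T hom_obj(1)[OF k']]] by auto
    qed
    show ?thesis
    proof (rule short_exactI[OF k u(1) _ K(2) u(3)])
      show "u n \<cdot> k n = zr (c n) (c (n - 1))" using zero_iff[OF k] K(1) by blast
      fix T t assume "t \<in> Hom T (X n)" "u n \<cdot> t = zr T (c (n - 1))"
      then show "\<exists>u\<in>Hom T (c n). k n \<cdot> u = t" using zero_iff K(3) by blast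
    qed
  qed
  with ker u(2) that show thesis by blast
qed

text \<open>\<open>cycle_iso\<close> only supplies some kernel with domain isomorphic to
  \<open>M\<close>; uniqueness of kernels transfers the isomorphism to the kernel \<open>k\<close>
  already chosen.\<close>

lemma cycle_iso_direct_sum:
  assumes "cycle_iso C X d n M" "is_kernel C (d n) k" "k \<in> Hom K (X n)" "d n \<in> Hom (X n) Y" "zero_obj C Z"
  shows "direct_sum C M K Z"
proof -
  obtain k' where k': "is_kernel C (d n) k'" "isomorphic C (c_dom C k') M"
    using assms(1) by (auto simp: cycle_iso_def)
  define K' where "K' = c_dom C k'"
  have k'h: "k' \<in> Hom K' (X n)"
    using k'(1) hom_arr(2)[OF assms(4)] by (simp add: is_kernel_def hom_def K'_def)
  obtain f where f: "f \<in> Hom K' M" "iso_mor C f" using k'(2) by (auto simp: isomorphic_def K'_def)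
  obtain g where g: "g \<in> Hom M K'" "g \<cdot> f = \<one> K'" "f \<cdot> g = \<one> M"
    using f(2) hom_arr[OF f(1)] by (auto simp: iso_mor_def)
  note D = kernelD[OF assms(2,4,3)] and D' = kernelD[OF k'(1) assms(4) k'h]
  obtain a where a: "a \<in> Hom K K'" "k' \<cdot> a = k" using D'(3)[OF assms(3) D(1)] by blast
  obtain b where b: "b \<in> Hom K' K" "k \<cdot> b = k'" using D(3)[OF k'h D'(1)] by blast
  have obj: "K \<in> c_obj C" "K' \<in> c_obj C" using a hom_obj by blast+
  have "k \<cdot> b \<cdot> a = k \<cdot> \<one> K" using comp_assoc[OF a(1) b(1) assms(3)] a b comp_id[OF assms(3)] by simp
  then have ba: "b \<cdot> a = \<one> K" using monoD[OF D(2) assms(3) comp_hom[OF a(1) b(1)] id_hom[OF obj(1)]] by blast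
  have "k' \<cdot> a \<cdot> b = k' \<cdot> \<one> K'" using comp_assoc[OF b(1) a(1) k'h] a b comp_id[OF k'h] by simp
  then have ab: "a \<cdot> b = \<one> K'" using monoD[OF D'(2) k'h comp_hom[OF b(1) a(1)] id_hom[OF obj(2)]] by blast
  have "(f \<cdot> a) \<cdot> b \<cdot> g = f \<cdot> (a \<cdot> b) \<cdot> g"
    using comp_assoc[OF comp_hom[OF g(1) b(1)] a(1) f(1)] comp_assoc[OF g(1) b(1) a(1)] by simp
  also have "\<dots> = \<one> M" using ab g id_comp[OF g(1)] by simp
  finally have 1: "(f \<cdot> a) \<cdot> b \<cdot> g = \<one> M" .
  have "(b \<cdot> g) \<cdot> f \<cdot> a = b \<cdot> (g \<cdot> f) \<cdot> a"
    using comp_assoc[OF comp_hom[OF a(1) f(1)] g(1) b(1)] comp_assoc[OF a(1) f(1) g(1)] by simp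
  also have "\<dots> = \<one> K" using ba g id_comp[OF a(1)] by simp
  finally show ?thesis
    using direct_sum_zero[OF comp_hom[OF g(1) b(1)] comp_hom[OF a(1) f(1)] 1 _ assms(5)] by blast
qed

lemma loops_if_is_loop:
  assumes m: "m \<ge> 1" and loop: "is_loop C \<W> m M X d"
    and from_U: "\<forall>W\<in>\<U>. hom_from_acyclic C W X d" and to_V: "\<forall>Y\<in>\<V>. hom_to_acyclic C Y X d"
  shows "M \<in> loops S m"
proof -
  have ex: "exact_complex C X d" and X: "\<And>n. X n \<in> \<W>"
    and cyc: "\<And>i::int. cycle_iso C X d (i * int m) M"
    using loop by (auto simp: is_loop_def)
  obtain c k u where ker: "\<And>n. is_kernel C (d n) (k n)" and d: "\<And>n. d n = k (n - 1) \<cdot> u n"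
    and se: "\<And>n. short_exact C (c n) (X n) (c (n - 1)) (k n) (u n)"
    using exact_complex_short_exact[OF ex] by metis
  note K = short_exactD[OF se]
  have dh: "d n \<in> Hom (X n) (X (n - 1))" for n using comp_hom[OF K(2) K(1)] d by simp
  \<comment> \<open>A map \<open>h\<close> into the cycles \<open>c (n - 1)\<close> becomes a
    cycle-valued map into \<open>X (n - 1)\<close>; acyclicity lifts it along \<open>d n\<close>,
    and cancelling the mono \<open>k (n - 1)\<close> gives a lift along \<open>u n\<close>.\<close>
  have Ext_U: "Ext1_zero C W (c n)" if W: "W \<in> \<U>" for W n
  proof (rule Ext1_zero_if_lift[OF se Ext_UW[OF W X]])
    fix h assume h: "h \<in> Hom W (c (n - 1))"
    have W': "W \<in> c_obj C" using h hom_obj by blast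
    have kh: "k (n - 1) \<cdot> h \<in> Hom W (X (n - 1))" using comp_hom[OF h K(1)] .
    have "d (n - 1) \<cdot> k (n - 1) \<cdot> h = zr W (X (n - 1 - 1))"
      using kernelD(1)[OF ker dh K(1)] comp_assoc[OF h K(1) dh] zr_comp[OF h K(9)] by simp
    then have "zero_mor C (d (n - 1) \<cdot> k (n - 1) \<cdot> h)" using zero_mor_iff[OF comp_hom[OF kh dh]] by simp
    then have "\<exists>g\<in>Hom W (X (n - 1 + 1)). d (n - 1 + 1) \<cdot> g = k (n - 1) \<cdot> h"
      using from_U W kh unfolding hom_from_acyclic_def by blast
    then obtain g where g: "g \<in> Hom W (X n)" "d n \<cdot> g = k (n - 1) \<cdot> h" by auto
    have "k (n - 1) \<cdot> u n \<cdot> g = k (n - 1) \<cdot> h" using comp_assoc[OF g(1) K(2) K(1)] g d[of n] by simp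
    then have "u n \<cdot> g = h" using monoD[OF K(4) K(1) comp_hom[OF g(1) K(2)] h] by blast
    then show "\<exists>\<gamma>\<in>Hom W (X n). u n \<cdot> \<gamma> = h" using g by blast
  qed
  \<comment> \<open>Dually, \<open>h\<close> precomposed with \<open>u (n + 1)\<close> kills
    \<open>d (n + 2)\<close>, so it extends along \<open>d (n + 1)\<close>. The sequence starting at
    \<open>c n\<close> yields the vanishing for its quotient \<open>c (n - 1)\<close>.\<close>
  have Ext_V': "Ext1_zero C (c (n - 1)) Y" if Y: "Y \<in> \<V>" for Y n
  proof (rule Ext1_zero_if_extend[OF se Ext_WV[OF X Y]])
    fix h assume h: "h \<in> Hom (c n) Y"
    have u1: "u (n + 1) \<in> Hom (X (n + 1)) (c n)" using K(2)[of "n + 1"] by simp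
    have k1: "k (n + 1) \<in> Hom (c (n + 1)) (X (n + 1))" using K(1) .
    have u2: "u (n + 2) \<in> Hom (X (n + 2)) (c (n + 1))"
      using K(2)[of "n + 2"] by (simp add: add.commute)
    have d2: "d (n + 2) = k (n + 1) \<cdot> u (n + 2)" using d[of "n + 2"] by (simp add: add.commute)
    have d2h: "d (n + 2) \<in> Hom (X (n + 2)) (X (n + 1))" using comp_hom[OF u2 k1] d2 by simp
    have hu: "h \<cdot> u (n + 1) \<in> Hom (X (n + 1)) Y" using comp_hom[OF u1 h] .
    have obj: "X (n + 2) \<in> c_obj C" "c n \<in> c_obj C" "Y \<in> c_obj C" using K(8,9) h hom_obj by blast+
    have "u (n + 1) \<cdot> d (n + 2) = zr (X (n + 2)) (c n)"
      using d2 comp_assoc[OF u2 k1 u1] K(3)[of "n + 1"] zr_comp[OF u2 obj(2)] by simp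
    then have "(h \<cdot> u (n + 1)) \<cdot> d (n + 2) = zr (X (n + 2)) Y"
      using comp_assoc[OF d2h u1 h] comp_zr[OF h obj(1)] by simp
    then have "zero_mor C ((h \<cdot> u (n + 1)) \<cdot> d (n + 1 + 1))"
      using zero_mor_iff[OF comp_hom[OF d2h hu]] by (simp add: add.assoc)
    then have "\<exists>g\<in>Hom (X (n + 1 - 1)) Y. g \<cdot> d (n + 1) = h \<cdot> u (n + 1)"
      using to_V Y hu unfolding hom_to_acyclic_def by blast
    then obtain g where g: "g \<in> Hom (X n) Y" "g \<cdot> d (n + 1) = h \<cdot> u (n + 1)" by auto
    have "(g \<cdot> k n) \<cdot> u (n + 1) = h \<cdot> u (n + 1)"
      using comp_assoc[OF u1 K(1) g(1)] g d[of "n + 1"] by simp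
    then have "g \<cdot> k n = h"
      using epiD[OF K(5)[of "n + 1"] u1 comp_hom[OF K(1) g(1)] h] by blast
    then show "\<exists>\<gamma>\<in>Hom (X n) Y. \<gamma> \<cdot> k n = h" using g by blast
  qed
  have Ext_V: "Ext1_zero C (c n) Y" if "Y \<in> \<V>" for Y n using Ext_V'[OF that, of "n + 1"] by simp
  have cT: "c n \<in> T" for n using Ext_U Ext_V K(8) by (simp add: T_iff)
  have "(c n, c (n - 1)) \<in> S" for n unfolding step_def using cT X se by blast
  \<comment> \<open>Steps lower the degree, so the walk of length \<open>m\<close> runs from
    \<open>c (int m)\<close> down to \<open>c 0\<close>.\<close>
  then have st: "(c (n + 1), c n) \<in> S" for n by (metis add_diff_cancel_right')
  have "(c (int j), c 0) \<in> S ^^ j" for j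
  proof (induction j)
    case (Suc j)
    then show ?case using st[of "int j"] relpow_Suc_I2 by (metis of_nat_Suc add.commute)
  qed simp
  then have cm: "(c (int m), c 0) \<in> S ^^ m" .
  obtain Z where Z: "zero_obj C Z" by (rule zero_obj_ex)
  \<comment> \<open>\<open>M\<close> is only isomorphic to these two cycles, so the ends of the walk
    must be replaced.\<close>
  have ds: "direct_sum C M (c (int m)) Z" "direct_sum C M (c 0) Z"
    using cycle_iso_direct_sum[OF cyc[of 1] ker K(1) dh Z] cycle_iso_direct_sum[OF cyc[of 0] ker K(1) dh Z]
    by simp_all
  have "(M, M) \<in> S ^^ m"
    using cm m
  proof (rule relpow_change_ends)
    show "(c (int m), z) \<in> S \<Longrightarrow> (M, z) \<in> S" for z using step_drop_left[OF _ ds(1) zero_in[OF Z]] .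
    show "(z, c 0) \<in> S \<Longrightarrow> (z, M) \<in> S" for z using step_drop_right[OF _ ds(2) zero_in[OF Z]] .
  qed
  then show ?thesis by (simp add: loops_def)
qed

text \<open>Unroll the closed walk periodically, take the middle terms of its steps as components,
  and splice the short exact sequences.\<close>

lemma is_loop_if_loops:
  assumes m: "m \<ge> 1" and M: "M \<in> loops S m"
  obtains X d where "is_loop C \<W> m M X d" "\<forall>W\<in>\<U>. hom_from_acyclic C W X d"
    "\<forall>Y\<in>\<V>. hom_to_acyclic C Y X d"
proof -
  obtain z where z: "z 0 = M" "z m = M" "\<And>i. i < m \<Longrightarrow> (z i, z (Suc i)) \<in> S"
    using M unfolding loops_def relpow_fun_conv by auto
  \<comment> \<open>The sign appears because walking forward along \<open>z\<close> lowers the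
    degree; degrees divisible by \<open>m\<close> carry \<open>z 0\<close>, which is
    \<open>M\<close>.\<close>
  define c where "c n = z (nat ((- n) mod int m))" for n :: int
  have "(c n, c (n - 1)) \<in> S" for n
  proof -
    define a where "a = nat ((- n) mod int m)"
    have a: "int a = (- n) mod int m" "a < m" using m by (auto simp: a_def nat_less_iff)
    have "(- (n - 1)) mod int m = ((- n) mod int m + 1) mod int m" by (simp add: mod_simps add.commute)
    then have "(- (n - 1)) mod int m = int (Suc a) mod int m" using a by (simp add: add.commute)
    then have "nat ((- (n - 1)) mod int m) = Suc a mod m" by (metis nat_int zmod_int)
    \<comment> \<open>At \<open>Suc a = m\<close> the index wraps to zero, where \<open>z 0\<close>
      and \<open>z m\<close> agree.\<close>
    then have "c (n - 1) = z (Suc a)" using a(2) z(1,2) by (cases "Suc a = m") (auto simp: c_def)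
    then show ?thesis using z(3)[OF a(2)] by (simp add: c_def a_def)
  qed
  then have "\<exists>E f g. E \<in> \<W> \<and> c n \<in> T \<and> short_exact C (c n) E (c (n - 1)) f g" for n
    unfolding step_def by blast
  then obtain X k u where X: "\<And>n. X n \<in> \<W>" and cT: "\<And>n. c n \<in> T"
    and se: "\<And>n. short_exact C (c n) (X n) (c (n - 1)) (k n) (u n)"
    by metis
  note K = short_exactD[OF se]
  define d where "d n = k (n - 1) \<cdot> u n" for n
  have dh: "d n \<in> Hom (X n) (X (n - 1))" for n using comp_hom[OF K(2) K(1)] d_def by simp
  have zero_iff: "u n \<cdot> t = zr A (c (n - 1)) \<longleftrightarrow> d n \<cdot> t = zr A (X (n - 1))" if t: "t \<in> Hom A (X n)" for A t n
  proof -
    have A: "A \<in> c_obj C" using t hom_obj by blast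
    have "d n \<cdot> t = k (n - 1) \<cdot> u n \<cdot> t" using comp_assoc[OF t K(2) K(1)] d_def by simp
    moreover have "zr A (X (n - 1)) = k (n - 1) \<cdot> zr A (c (n - 1))" using comp_zr[OF K(1) A] by simp
    ultimately show ?thesis using monoD[OF K(4) K(1) comp_hom[OF t K(2)] zr_hom[OF A K(8)]] by auto
  qed
  have ker: "is_kernel C (d n) (k n)" for n
  proof (rule kernelI[OF dh K(1) _ K(4)])
    show "d n \<cdot> k n = zr (c n) (X (n - 1))" using zero_iff[OF K(1)] K(3) by blast
    show "\<exists>u\<in>Hom A (c n). k n \<cdot> u = t" if "t \<in> Hom A (X n)" "d n \<cdot> t = zr A (X (n - 1))" for A t
      using that zero_iff K(6) by blast
  qed
  have u1: "u (n + 1) \<in> Hom (X (n + 1)) (c n)" "d (n + 1) = k n \<cdot> u (n + 1)"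
    "d (n + 1) \<in> Hom (X (n + 1)) (X n)" for n
    using K(2)[of "n + 1"] dh[of "n + 1"] by (simp_all add: d_def)
  have dd: "zero_mor C (d n \<cdot> d (n + 1))" for n
  proof -
    have "d n \<cdot> d (n + 1) = (d n \<cdot> k n) \<cdot> u (n + 1)" using comp_assoc[OF u1(1) K(1) dh] u1(2) by simp
    also have "\<dots> = zr (X (n + 1)) (X (n - 1))"
      using kernelD(1)[OF ker dh K(1)] zr_comp[OF u1(1) K(9)] by simp
    finally show ?thesis using zero_mor_iff[OF comp_hom[OF u1(3) dh]] by blast
  qed
  have "exact_at C (d (n + 1)) (d n)" for n
    unfolding exact_at_def
    using ker[of n] u1[of n] K(5)[of "n + 1"] dd[of n] hom_arr[OF u1(3)[of n]] hom_arr[OF dh[of n]]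
      hom_arr(2)[OF K(1)[of n]] by metis
  moreover have "chain_complex C X d"
    unfolding chain_complex_def using dh K(9) dd[of "n - 1" for n] by simp
  ultimately have ex: "exact_complex C X d" by (simp add: exact_complex_def)
  have "cycle_iso C X d (i * int m) M" for i
  proof -
    have "c (i * int m) = M" using z by (simp add: c_def mod_minus_eq[symmetric] flip: mult_minus_left)
    then have kM: "k (i * int m) \<in> Hom M (X (i * int m))" using K(1)[of "i * int m"] by simp
    have M': "M \<in> c_obj C" using kM hom_obj by blast
    have "isomorphic C M M"
      unfolding isomorphic_def iso_mor_def
      using id_hom[OF M'] comp_id[OF id_hom[OF M']] hom_arr[OF id_hom[OF M']] by metis
    then show ?thesis
      unfolding cycle_iso_def using ker hom_arr(2)[OF kM] by metis
  qed
  then have "is_loop C \<W> m M X d" using ex X by (simp add: is_loop_def)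
  moreover have "hom_from_acyclic C W X d" if W: "W \<in> \<U>" for W
    unfolding hom_from_acyclic_def
  proof (intro allI ballI impI)
    fix n f assume f: "f \<in> Hom W (X n)" "zero_mor C (d n \<cdot> f)"
    then have "d n \<cdot> f = zr W (X (n - 1))" using zero_mor_iff[OF comp_hom[OF f(1) dh]] by simp
    then obtain f' where f': "f' \<in> Hom W (c n)" "k n \<cdot> f' = f" using kernelD(3)[OF ker dh K(1) f(1)] by blast
    have se1: "short_exact C (c (n + 1)) (X (n + 1)) (c n) (k (n + 1)) (u (n + 1))" using se[of "n + 1"] by simp
    have "Ext1_zero C W (c (n + 1))" using cT W by (auto simp: T_iff)
    then obtain g where g: "g \<in> Hom W (X (n + 1))" "u (n + 1) \<cdot> g = f'"
      using lift_if_Ext1_zero[OF se1 _ f'(1)] by blast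
    have "d (n + 1) \<cdot> g = f" using comp_assoc[OF g(1) u1(1) K(1)] u1(2) g f' by simp
    then show "\<exists>g\<in>Hom W (X (n + 1)). d (n + 1) \<cdot> g = f" using g by blast
  qed
  moreover have "hom_to_acyclic C Y X d" if Y: "Y \<in> \<V>" for Y
    unfolding hom_to_acyclic_def
  proof (intro allI ballI impI)
    fix n f assume f: "f \<in> Hom (X n) Y" "zero_mor C (f \<cdot> d (n + 1))"
    have Y': "Y \<in> c_obj C" using f hom_obj by blast
    have fk: "f \<cdot> k n \<in> Hom (c n) Y" using comp_hom[OF K(1) f(1)] .
    have "(f \<cdot> k n) \<cdot> u (n + 1) = f \<cdot> d (n + 1)" using comp_assoc[OF u1(1) K(1) f(1)] u1(2) by simp
    also have "\<dots> = zr (X (n + 1)) Y" using zero_mor_iff[OF comp_hom[OF u1(3) f(1)]] f by simp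
    also have "\<dots> = zr (c n) Y \<cdot> u (n + 1)" using zr_comp[OF u1(1) Y'] by simp
    \<comment> \<open>The epi \<open>u (n + 1)\<close> cancels, so \<open>f\<close> vanishes on
      cycles and descends to \<open>c (n - 1)\<close>.\<close>
    finally have "f \<cdot> k n = zr (c n) Y"
      using epiD[OF K(5)[of "n + 1"] u1(1) fk zr_hom[OF K(8) Y']] by blast
    then obtain f' where f': "f' \<in> Hom (c (n - 1)) Y" "f' \<cdot> u n = f" using K(7)[OF f(1)] by blast
    \<comment> \<open>The map \<open>f'\<close> on \<open>c (n - 1)\<close> must extend to
      \<open>X (n - 1)\<close>; the obstruction lives on the quotient, which is the cycle two
      degrees below \<open>n\<close>.\<close>
    have "Ext1_zero C (c (n - 1 - 1)) Y" using cT Y by (auto simp: T_iff)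
    then obtain g where g: "g \<in> Hom (X (n - 1)) Y" "g \<cdot> k (n - 1) = f'"
      using extend_if_Ext1_zero[OF se _ f'(1)] by blast
    have "g \<cdot> d n = f" using comp_assoc[OF K(2)[of n] K(1) g(1)] g f' d_def by simp
    then show "\<exists>g\<in>Hom (X (n - 1)) Y. g \<cdot> d n = f" using g by blast
  qed
  ultimately show thesis using that by blast
qed

end

text \<open>Proper loops are tested by maps from their own class of components, so
  \<open>\<U>\<close> is specialised to \<open>\<W>\<close>.\<close>

lemma piGP_ppr_eq_loops:
  assumes "loop_setting C \<W> \<W> \<V>" "m \<ge> 1"
  shows "piGP_ppr C \<W> \<V> m = loops (step C \<W> \<W> \<V>) m"
proof -
  interpret loop_setting C \<W> \<W> \<V> by fact
  show ?thesis
  proof (intro set_eqI iffI)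
    fix M assume "M \<in> piGP_ppr C \<W> \<V> m"
    then show "M \<in> loops S m" using loops_if_is_loop[OF assms(2)] by (auto simp: piGP_ppr_def)
  next
    fix M assume M: "M \<in> loops S m"
    then have "M \<in> c_obj C" using loops_sub_T[OF assms(2)] by (auto simp: T_iff)
    moreover obtain X d where "is_loop C \<W> m M X d" "\<forall>W\<in>\<W>. hom_from_acyclic C W X d"
      "\<forall>Y\<in>\<V>. hom_to_acyclic C Y X d"
      using is_loop_if_loops[OF assms(2) M] by metis
    ultimately show "M \<in> piGP_ppr C \<W> \<V> m" unfolding piGP_ppr_def by blast
  qed
qed

theorem theorem5p3:
  fixes C :: "('o,'m) category" and \<A> \<B> :: "'o set" and m :: nat
  assumes "abelian C"
    and "m \<ge> 1"
    and "\<A> \<subseteq> c_obj C" and "\<B> \<subseteq> c_obj C"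
    and "Ext1_zero_classes C \<A> \<B>"
    and "closed_fin_coproducts C (\<A> \<inter> \<B>)"
    and "closed_summands C (\<A> \<inter> \<B>)"
  shows
   "(\<forall>M N W i j. N \<in> c_obj C \<and> W \<in> \<A> \<inter> \<B> \<and> is_coproduct C N W M i j \<longrightarrow>
        (M \<in> piGP_ppr C (\<A> \<inter> \<B>) \<B> m \<longleftrightarrow> N \<in> piGP_ppr C (\<A> \<inter> \<B>) \<B> m))
    \<and>
    (let P = piGP_ppr C (\<A> \<inter> \<B>) \<B> m in
     ((\<forall>X Y Z f g. short_exact C X Y Z f g \<and> X \<in> P \<and> Z \<in> P \<longrightarrow> Y \<in> P)
      \<longleftrightarrow>
      (\<forall>X Y Z f g. short_exact C X Y Z f g \<and> Y \<in> P \<and> Z \<in> P \<longrightarrow>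
         (X \<in> P \<longleftrightarrow> X \<in> right_perp1 C (\<A> \<inter> \<B>))))
     \<and>
     ((\<forall>X Y Z f g. short_exact C X Y Z f g \<and> X \<in> P \<and> Z \<in> P \<longrightarrow> Y \<in> P)
      \<longleftrightarrow>
      (\<forall>X Y Z f g. short_exact C X Y Z f g \<and> X \<in> P \<and> Y \<in> P \<longrightarrow>
         (Z \<in> P \<longleftrightarrow> Z \<in> left_perp1 C \<B>))))"
proof -
  interpret abelian_category C using assms(1) by unfold_locales
  have setting: "loop_setting C (\<A> \<inter> \<B>) (\<A> \<inter> \<B>) \<B>"
  proof
    show "Z \<in> \<A> \<inter> \<B>" if "zero_obj C Z" for Z
      using assms(6) that unfolding closed_fin_coproducts_def by blast
    \<comment> \<open>Closure under coproducts gives one direction and closure under summands the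
      other, once the splitting is rewritten as a coproduct.\<close>
    show "E \<in> \<A> \<inter> \<B> \<longleftrightarrow> A \<in> \<A> \<inter> \<B> \<and> B \<in> \<A> \<inter> \<B>" if ds: "direct_sum C A E B" for A E B
    proof -
      obtain i j where ij: "is_coproduct C A B E i j" using direct_sumE[OF ds] by metis
      have "A \<in> c_obj C" "B \<in> c_obj C" using coproductD(1,2)[OF ij] hom_obj by blast+
      then show ?thesis
        using assms(6,7) ij unfolding closed_fin_coproducts_def closed_summands_def by blast
    qed
    show "Ext1_zero C A B" if "A \<in> \<A> \<inter> \<B>" "B \<in> \<A> \<inter> \<B>" for A B
      using assms(5) that unfolding Ext1_zero_classes_def by blast
    show "Ext1_zero C A B" if "A \<in> \<A> \<inter> \<B>" "B \<in> \<B>" for A B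
      using assms(5) that unfolding Ext1_zero_classes_def by blast
  qed (use assms(3) in auto)
  interpret loop_setting C "\<A> \<inter> \<B>" "\<A> \<inter> \<B>" \<B> by (rule setting)
  have summand: "\<forall>M N W i j. N \<in> c_obj C \<and> W \<in> \<A> \<inter> \<B> \<and> is_coproduct C N W M i j \<longrightarrow>
      (M \<in> loops S m \<longleftrightarrow> N \<in> loops S m)"
    using loops_direct_sum[OF assms(2)] direct_sum_coproduct by blast
  show ?thesis
    unfolding piGP_ppr_eq_loops[OF setting assms(2)] Let_def
    using summand ext_closed_iff_kernels[OF assms(2)] ext_closed_iff_cokernels[OF assms(2)]
    unfolding ext_closed_def by (intro conjI)
qed

end
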